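(* Assume $L_0<e^{-1}$ and $c_2(L_1,L_1)<1$ (the quantities $L_0,L_1,c_1(\cdot),L_2(\cdot),c_2(\cdot,\cdot)$ being the explicit functions of $T$ and of the constants of the coefficients given in the context). (i) For any $\bar L>L_1$, $\bar G>L_1$, $L_2>L_2(L_1)$ and $c_1(L_1)<c_1<1$, if $h=T/n$ is small enough, there exists a solution $u^n=(u^n_i)_{0\le i\le n}$ of the backward recursion (R) of the context such that $$L(u^n)\le \bar L,\qquad G(u^n)\le \bar G,\qquad H(u^n)\le \bar H:=\frac{L_2}{1-c_1}.$$ (ii) For any $c_2$ with $c_2(L_1,L_1)<c_2<1$ and for $h$ small enough, for all $m\ge 1$ and all $x\in\mathbb{R}$, $$\max_{0\le i\le n}|u_i^{n,m}(x)-u_i^n(x)|^2\le \frac{3\bar G}{(1-\sqrt{c_2})^2}|x|^2c_2^m+\frac{3}{(1-\sqrt{c_2})^4}\left[\frac{\bar H}{m}+[b_0+\sigma_0+(b_y+\sigma_y)\bar H]\,T\bar G\right]m\,c_2^m .$$ (iii) Fix $G>0$ and suppose $\tilde u^n$ is another solution of (R) with linear growth such that $G(\tilde u^n)\le G$. Then $\tilde u^n=u^n$, if $h$ (depending on $G$) is small enough.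
   Context: **Setting.** $T>0$; all processes are one-dimensional; $W$ is a Brownian motion on $[0,T]$. For $n\in\mathbb{N}$, $h:=T/n$, $t_i:=ih$, $\Delta W_{i+1}:=W_{t_{i+1}}-W_{t_i}$. The (measurable, deterministic) functions $b,\sigma:[0,T]\times\mathbb{R}^2\to\mathbb{R}$, $f:[0,T]\times\mathbb{R}^3\to\mathbb{R}$, $g:\mathbb{R}\to\mathbb{R}$ satisfy the following standing assumption. There are real (possibly negative) constants $k_b,k_f$ and nonnegative constants $K,b_y,\sigma_x,\sigma_y,f_x,f_z,g_x,b_0,\sigma_0,f_0,g_0$, with $K$ an upper bound for all the others, such that for all arguments, with $\Delta x=x_1-x_2$, $\Delta y=y_1-y_2$, $\Delta z=z_1-z_2$: $[b(t,x_1,y)-b(t,x_2,y)]\Delta x\le k_b|\Delta x|^2$; $[f(t,x,y_1,z)-f(t,x,y_2,z)]\Delta y\le k_f|\Delta y|^2$; $|b(t,x_1,y_1)-b(t,x_2,y_2)|^2\le K|\Delta x|^2+b_y|\Delta y|^2$; $|\sigma(t,x_1,y_1)-\sigma(t,x_2,y_2)|^2\le \sigma_x|\Delta x|^2+\sigma_y|\Delta y|^2$; $|f(t,x_1,y_1,z_1)-f(t,x_2,y_2,z_2)|^2\le f_x|\Delta x|^2+K|\Delta y|^2+f_z|\Delta z|^2$; $|g(x_1)-g(x_2)|^2\le g_x|\Delta x|^2$; $|b(t,x,y)|^2\le b_0+K|x|^2+b_y|y|^2$; $|\sigma(t,x,y)|^2\le\sigma_0+\sigma_x|x|^2+\sigma_y|y|^2$;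 $|f(t,x,y,z)|^2\le f_0+f_x|x|^2+K|y|^2+f_z|z|^2$; $|g(x)|^2\le g_0+g_x|x|^2$. **Operator $F_n$.** For measurable functions $\varphi=\{\varphi_i\}_{0\le i\le n-1}$ on $\mathbb{R}$, define $F_n(\varphi):=\Phi=\{\Phi_i\}_{0\le i\le n}$ by $\Phi_n:=g$ and, backward for $i=n-1,\dots,0$, $X_{i+1}^{\varphi,i,x}:=x+b(t_i,x,\varphi_i(x))h+\sigma(t_i,x,\varphi_i(x))\Delta W_{i+1}$, $Y_{i+1}^{\varphi,i,x}:=\Phi_{i+1}(X_{i+1}^{\varphi,i,x})$, $\psi_i(x):=\frac1hE\{Y_{i+1}^{\varphi,i,x}\Delta W_{i+1}\}$, $\Phi_i(x):=E\{Y_{i+1}^{\varphi,i,x}+f(t_i,x,Y_{i+1}^{\varphi,i,x},\psi_i(x))h\}$. **Markovian iteration.** $u^{n,0}:=0$ and $u^{n,m}:=F_n(u^{n,m-1})$ for $m\ge1$. **Recursion (R).** $u^n=(u_i^n)_{0\le i\le n}$ solves (R) if $u^n_n=g$ and for all $i=n-1,\dots,0$, $x\in\mathbb{R}$: $X_{i+1}^{n,i,x}:=x+b(t_i,x,u_i^n(x))h+\sigma(t_i,x,u^n_i(x))\Delta W_{i+1}$, $Y_{i+1}^{n,i,x}:=u_{i+1}^n(X_{i+1}^{n,i,x})$, $v_i^n(x):=\frac1hE\{Y_{i+1}^{n,i,x}\Delta W_{i+1}\}$, $u_i^n(x)=E\{Y_{i+1}^{n,i,x}+f(t_i,x,Y_{i+1}^{n,i,x},v_i^n(x))h\}$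 (equivalently $F_n(u^n)=u^n$). **Notation $L,G,H$.** For a family $\varphi=(\varphi_i)$: $L(\varphi)$ is a constant with $|\varphi_i(x_1)-\varphi_i(x_2)|^2\le L(\varphi)|x_1-x_2|^2$ for all $i,x_1,x_2$ (the square of a common Lipschitz constant); $G(\varphi),H(\varphi)$ are constants with $|\varphi_i(x)|^2\le G(\varphi)|x|^2+H(\varphi)$ for all $i,x$. These are not unique; an assertion "$L(\varphi)\le a$", resp. "$G(\varphi)\le a$, $H(\varphi)\le c$", means that the corresponding inequality holds with constant $a$, resp. with the pair $(a,c)$. "$G(\varphi)\le a$" alone means that it holds with $a$ and some finite $H(\varphi)$. **Constants.** $L_0:=[b_y+\sigma_y][g_x+f_xT]\,T\,e^{[b_y+\sigma_y][g_x+f_xT]T+[2k_b+2k_f+2+\sigma_x+f_z]T}$, $L_1:=[g_x+f_xT]\left[e^{[b_y+\sigma_y][g_x+f_xT]T+[2k_b+2k_f+2+\sigma_x+f_z]T+1}\vee1\right]$. $\Gamma_0(x):=\frac{e^x-1}{x}$ (with $\Gamma_0(0)=1$), $\Gamma_1(x,y):=\sup_{0<\theta<1}\theta e^{\theta x}\Gamma_0(\theta y)$. For $G>0$: $c_0(G):=T\big[g_x\Gamma_1([2k_f+1+f_z]T,[2k_b+1+\sigma_x]T+[b_y+\sigma_y]GT)+f_xT\,\Gamma_0([2k_f+1+f_z]T)\Gamma_0([2k_b+1+\sigma_x]T+[b_y+\sigma_y]GT)\big]$, $c_1(G):=[b_y+\sigma_y]c_0(G)$, $L_2(G):=e^{[2k_f+1+f_z]^+T}g_0+f_0T\,\Gamma_0([2k_f+1+f_z]T)+[b_0+\sigma_0]c_0(G)$.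 For $\lambda_1>0$: $c_2(\lambda_1,L,G):=\big[e^{[2k_b+1+\sigma_x+[b_y+\sigma_y]G]T}\vee1\big](1+\lambda_1^{-1})[b_y+\sigma_y]T\big[g_x\Gamma_1([2k_f+1+f_z]T,[2k_b+1+\sigma_x+(1+\lambda_1)[b_y+\sigma_y]L]T)+f_xT\,\Gamma_0([2k_f+1+f_z]T)\Gamma_0([2k_b+1+\sigma_x+(1+\lambda_1)[b_y+\sigma_y]L]T)\big]$, $c_2(L,G):=\inf_{\lambda_1>0}c_2(\lambda_1,L,G)$. In (ii) and (iii), $\bar L,\bar G,\bar H$ and $u^n$ are those of (i). *)

theory Defs
  imports "HOL-Probability.Probability"
begin

section \<open>Brownian motion\<close>

locale brownian_motion = prob_space M
  for M :: "'a measure" and W :: "real \<Rightarrow> 'a \<Rightarrow> real" and T :: real +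
  assumes W_measurable: "\<And>t. t \<in> {0..T} \<Longrightarrow> W t \<in> borel_measurable M"
    and W_zero: "AE \<omega> in M. W 0 \<omega> = 0"
    and W_increment: "\<And>s t. 0 \<le> s \<Longrightarrow> s < t \<Longrightarrow> t \<le> T \<Longrightarrow>
          distributed M lborel (\<lambda>\<omega>. W t \<omega> - W s \<omega>) (normal_density 0 (sqrt (t - s)))"
    and W_indep: "\<And>(s :: nat \<Rightarrow> real) k. (\<forall>j\<le>k. s j \<in> {0..T}) \<Longrightarrow> (\<forall>j<k. s j < s (Suc j)) \<Longrightarrow>
          indep_vars (\<lambda>_. borel) (\<lambda>j \<omega>. W (s (Suc j)) \<omega> - W (s j) \<omega>) {..<k}"
    and W_continuous: "AE \<omega> in M. continuous_on {0..T} (\<lambda>t. W t \<omega>)"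

section \<open>Coefficients and the standing assumption\<close>

record bounds =
  k_b :: real
  k_f :: real
  K_ub :: real
  b_y :: real
  \<sigma>_x :: real
  \<sigma>_y :: real
  f_x :: real
  f_z :: real
  g_x :: real
  b_0 :: real
  \<sigma>_0 :: real
  f_0 :: real
  g_0 :: real

text \<open>The coefficients are only constrained for times in \<open>[0,T]\<close>; their values outside are irrelevant.
  The monotonicity constants \<open>k_b\<close>, \<open>k_f\<close> may be negative.\<close>

definition standing_assumption ::
  "real \<Rightarrow> bounds \<Rightarrow> (real \<Rightarrow> real \<Rightarrow> real \<Rightarrow> real) \<Rightarrow> (real \<Rightarrow> real \<Rightarrow> real \<Rightarrow> real) \<Rightarrow>
    (real \<Rightarrow> real \<Rightarrow> real \<Rightarrow> real \<Rightarrow> real) \<Rightarrow> (real \<Rightarrow> real) \<Rightarrow> bool" where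
  "standing_assumption T C b \<sigma> f g \<longleftrightarrow>
    (\<lambda>(t, x, y). b t x y) \<in> borel_measurable (restrict_space borel ({0..T} \<times> UNIV)) \<and>
    (\<lambda>(t, x, y). \<sigma> t x y) \<in> borel_measurable (restrict_space borel ({0..T} \<times> UNIV)) \<and>
    (\<lambda>(t, x, y, z). f t x y z) \<in> borel_measurable (restrict_space borel ({0..T} \<times> UNIV)) \<and>
    g \<in> borel_measurable borel \<and>
    (\<forall>c \<in> {K_ub C, b_y C, \<sigma>_x C, \<sigma>_y C, f_x C, f_z C, g_x C, b_0 C, \<sigma>_0 C, f_0 C, g_0 C}. 0 \<le> c) \<and>
    (\<forall>c \<in> {k_b C, k_f C, b_y C, \<sigma>_x C, \<sigma>_y C, f_x C, f_z C, g_x C, b_0 C, \<sigma>_0 C, f_0 C, g_0 C}.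
        c \<le> K_ub C) \<and>
    (\<forall>t \<in> {0..T}. \<forall>x1 x2 y.
      (b t x1 y - b t x2 y) * (x1 - x2) \<le> k_b C * \<bar>x1 - x2\<bar>\<^sup>2) \<and>
    (\<forall>t \<in> {0..T}. \<forall>x y1 y2 z.
      (f t x y1 z - f t x y2 z) * (y1 - y2) \<le> k_f C * \<bar>y1 - y2\<bar>\<^sup>2) \<and>
    (\<forall>t \<in> {0..T}. \<forall>x1 x2 y1 y2.
      \<bar>b t x1 y1 - b t x2 y2\<bar>\<^sup>2 \<le> K_ub C * \<bar>x1 - x2\<bar>\<^sup>2 + b_y C * \<bar>y1 - y2\<bar>\<^sup>2) \<and>
    (\<forall>t \<in> {0..T}. \<forall>x1 x2 y1 y2.
      \<bar>\<sigma> t x1 y1 - \<sigma> t x2 y2\<bar>\<^sup>2 \<le> \<sigma>_x C * \<bar>x1 - x2\<bar>\<^sup>2 + \<sigma>_y C * \<bar>y1 - y2\<bar>\<^sup>2) \<and>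
    (\<forall>t \<in> {0..T}. \<forall>x1 x2 y1 y2 z1 z2.
      \<bar>f t x1 y1 z1 - f t x2 y2 z2\<bar>\<^sup>2
        \<le> f_x C * \<bar>x1 - x2\<bar>\<^sup>2 + K_ub C * \<bar>y1 - y2\<bar>\<^sup>2 + f_z C * \<bar>z1 - z2\<bar>\<^sup>2) \<and>
    (\<forall>x1 x2. \<bar>g x1 - g x2\<bar>\<^sup>2 \<le> g_x C * \<bar>x1 - x2\<bar>\<^sup>2) \<and>
    (\<forall>t \<in> {0..T}. \<forall>x y. \<bar>b t x y\<bar>\<^sup>2 \<le> b_0 C + K_ub C * \<bar>x\<bar>\<^sup>2 + b_y C * \<bar>y\<bar>\<^sup>2) \<and>
    (\<forall>t \<in> {0..T}. \<forall>x y. \<bar>\<sigma> t x y\<bar>\<^sup>2 \<le> \<sigma>_0 C + \<sigma>_x C * \<bar>x\<bar>\<^sup>2 + \<sigma>_y C * \<bar>y\<bar>\<^sup>2) \<and>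
    (\<forall>t \<in> {0..T}. \<forall>x y z.
      \<bar>f t x y z\<bar>\<^sup>2 \<le> f_0 C + f_x C * \<bar>x\<bar>\<^sup>2 + K_ub C * \<bar>y\<bar>\<^sup>2 + f_z C * \<bar>z\<bar>\<^sup>2) \<and>
    (\<forall>x. \<bar>g x\<bar>\<^sup>2 \<le> g_0 C + g_x C * \<bar>x\<bar>\<^sup>2)"

section \<open>The operator, the Markovian iteration and the backward recursion\<close>

text \<open>One backward step from \<open>t\<^sub>i\<^sub>+\<^sub>1\<close> to \<open>t\<^sub>i\<close>: \<open>p\<close> is the function of \<open>x\<close> inserted into the forward
  coefficients, \<open>q\<close> is the function evaluated at the Euler step. When \<open>q\<close> is measurable with linear
  growth, all integrands are integrable under the standing assumption, so the convention that the
  Bochner integral of a non-integrable function is \<open>0\<close> plays no role.\<close>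

definition step ::
  "'a measure \<Rightarrow> (real \<Rightarrow> 'a \<Rightarrow> real) \<Rightarrow> real \<Rightarrow> (real \<Rightarrow> real \<Rightarrow> real \<Rightarrow> real) \<Rightarrow>
    (real \<Rightarrow> real \<Rightarrow> real \<Rightarrow> real) \<Rightarrow> (real \<Rightarrow> real \<Rightarrow> real \<Rightarrow> real \<Rightarrow> real) \<Rightarrow>
    nat \<Rightarrow> nat \<Rightarrow> (real \<Rightarrow> real) \<Rightarrow> (real \<Rightarrow> real) \<Rightarrow> real \<Rightarrow> real" where
  "step M W T b \<sigma> f n i p q x =
    (let h = T / real n;
         t = real i * h;
         dW = (\<lambda>\<omega>. W (real (Suc i) * h) \<omega> - W (real i * h) \<omega>);
         X = (\<lambda>\<omega>. x + b t x (p x) * h + \<sigma> t x (p x) * dW \<omega>);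
         Y = (\<lambda>\<omega>. q (X \<omega>));
         \<psi> = (1 / h) * (LINT \<omega>|M. Y \<omega> * dW \<omega>)
     in LINT \<omega>|M. Y \<omega> + f t x (Y \<omega>) \<psi> * h)"

function F_op ::
  "'a measure \<Rightarrow> (real \<Rightarrow> 'a \<Rightarrow> real) \<Rightarrow> real \<Rightarrow> (real \<Rightarrow> real \<Rightarrow> real \<Rightarrow> real) \<Rightarrow>
    (real \<Rightarrow> real \<Rightarrow> real \<Rightarrow> real) \<Rightarrow> (real \<Rightarrow> real \<Rightarrow> real \<Rightarrow> real \<Rightarrow> real) \<Rightarrow> (real \<Rightarrow> real) \<Rightarrow>
    nat \<Rightarrow> (nat \<Rightarrow> real \<Rightarrow> real) \<Rightarrow> nat \<Rightarrow> real \<Rightarrow> real" where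
  "F_op M W T b \<sigma> f g n \<phi> i =
    (if n \<le> i then g
     else step M W T b \<sigma> f n i (\<phi> i) (F_op M W T b \<sigma> f g n \<phi> (Suc i)))"
  by pat_completeness auto
termination
  by (relation "Wellfounded.measure (\<lambda>(M, W, T, b, \<sigma>, f, g, n, \<phi>, i). n - i)") auto

declare F_op.simps [simp del]

primrec markov_iter ::
  "'a measure \<Rightarrow> (real \<Rightarrow> 'a \<Rightarrow> real) \<Rightarrow> real \<Rightarrow> (real \<Rightarrow> real \<Rightarrow> real \<Rightarrow> real) \<Rightarrow>
    (real \<Rightarrow> real \<Rightarrow> real \<Rightarrow> real) \<Rightarrow> (real \<Rightarrow> real \<Rightarrow> real \<Rightarrow> real \<Rightarrow> real) \<Rightarrow> (real \<Rightarrow> real) \<Rightarrow>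
    nat \<Rightarrow> nat \<Rightarrow> nat \<Rightarrow> real \<Rightarrow> real" where
  "markov_iter M W T b \<sigma> f g n 0 = (\<lambda>i x. 0)"
| "markov_iter M W T b \<sigma> f g n (Suc m) =
    F_op M W T b \<sigma> f g n (markov_iter M W T b \<sigma> f g n m)"

text \<open>As for the operator, a solution is understood to consist of measurable functions.\<close>

definition solves_R ::
  "'a measure \<Rightarrow> (real \<Rightarrow> 'a \<Rightarrow> real) \<Rightarrow> real \<Rightarrow> (real \<Rightarrow> real \<Rightarrow> real \<Rightarrow> real) \<Rightarrow>
    (real \<Rightarrow> real \<Rightarrow> real \<Rightarrow> real) \<Rightarrow> (real \<Rightarrow> real \<Rightarrow> real \<Rightarrow> real \<Rightarrow> real) \<Rightarrow> (real \<Rightarrow> real) \<Rightarrow>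
    nat \<Rightarrow> (nat \<Rightarrow> real \<Rightarrow> real) \<Rightarrow> bool" where
  "solves_R M W T b \<sigma> f g n u \<longleftrightarrow>
    (\<forall>i\<le>n. u i \<in> borel_measurable borel) \<and>
    u n = g \<and>
    (\<forall>i<n. \<forall>x. u i x = step M W T b \<sigma> f n i (u i) (u (Suc i)) x)"

text \<open>\<open>L_le n \<phi> a\<close> and \<open>GH_le n \<phi> a c\<close> stand for \<open>L(\<phi>) \<le> a\<close> and \<open>G(\<phi>) \<le> a, H(\<phi>) \<le> c\<close>; \<open>a\<close> is the square
  of a common Lipschitz constant in the former.\<close>

definition L_le :: "nat \<Rightarrow> (nat \<Rightarrow> real \<Rightarrow> real) \<Rightarrow> real \<Rightarrow> bool" where
  "L_le n \<phi> a \<longleftrightarrow> (\<forall>i\<le>n. \<forall>x1 x2. \<bar>\<phi> i x1 - \<phi> i x2\<bar>\<^sup>2 \<le> a * \<bar>x1 - x2\<bar>\<^sup>2)"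

definition GH_le :: "nat \<Rightarrow> (nat \<Rightarrow> real \<Rightarrow> real) \<Rightarrow> real \<Rightarrow> real \<Rightarrow> bool" where
  "GH_le n \<phi> a c \<longleftrightarrow> (\<forall>i\<le>n. \<forall>x. \<bar>\<phi> i x\<bar>\<^sup>2 \<le> a * \<bar>x\<bar>\<^sup>2 + c)"

definition G_le :: "nat \<Rightarrow> (nat \<Rightarrow> real \<Rightarrow> real) \<Rightarrow> real \<Rightarrow> bool" where
  "G_le n \<phi> a \<longleftrightarrow> (\<exists>c. GH_le n \<phi> a c)"

section \<open>Constants\<close>

definition L0 :: "real \<Rightarrow> bounds \<Rightarrow> real" where
  "L0 T C = (b_y C + \<sigma>_y C) * (g_x C + f_x C * T) * T *
    exp ((b_y C + \<sigma>_y C) * (g_x C + f_x C * T) * T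
         + (2 * k_b C + 2 * k_f C + 2 + \<sigma>_x C + f_z C) * T)"

definition L1 :: "real \<Rightarrow> bounds \<Rightarrow> real" where
  "L1 T C = (g_x C + f_x C * T) *
    max (exp ((b_y C + \<sigma>_y C) * (g_x C + f_x C * T) * T
              + (2 * k_b C + 2 * k_f C + 2 + \<sigma>_x C + f_z C) * T + 1)) 1"

definition \<Gamma>0 :: "real \<Rightarrow> real" where
  "\<Gamma>0 x = (if x = 0 then 1 else (exp x - 1) / x)"

definition \<Gamma>1 :: "real \<Rightarrow> real \<Rightarrow> real" where
  "\<Gamma>1 x y = (SUP \<theta>\<in>{0<..<1}. \<theta> * exp (\<theta> * x) * \<Gamma>0 (\<theta> * y))"

definition c0_fun :: "real \<Rightarrow> bounds \<Rightarrow> real \<Rightarrow> real" where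
  "c0_fun T C G = T *
    (g_x C * \<Gamma>1 ((2 * k_f C + 1 + f_z C) * T)
                ((2 * k_b C + 1 + \<sigma>_x C) * T + (b_y C + \<sigma>_y C) * G * T)
     + f_x C * T * \<Gamma>0 ((2 * k_f C + 1 + f_z C) * T)
         * \<Gamma>0 ((2 * k_b C + 1 + \<sigma>_x C) * T + (b_y C + \<sigma>_y C) * G * T))"

definition c1_fun :: "real \<Rightarrow> bounds \<Rightarrow> real \<Rightarrow> real" where
  "c1_fun T C G = (b_y C + \<sigma>_y C) * c0_fun T C G"

definition L2_fun :: "real \<Rightarrow> bounds \<Rightarrow> real \<Rightarrow> real" where
  "L2_fun T C G = exp (max (2 * k_f C + 1 + f_z C) 0 * T) * g_0 C
    + f_0 C * T * \<Gamma>0 ((2 * k_f C + 1 + f_z C) * T)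
    + (b_0 C + \<sigma>_0 C) * c0_fun T C G"

definition c2_at :: "real \<Rightarrow> bounds \<Rightarrow> real \<Rightarrow> real \<Rightarrow> real \<Rightarrow> real" where
  "c2_at T C lam L G =
    max (exp ((2 * k_b C + 1 + \<sigma>_x C + (b_y C + \<sigma>_y C) * G) * T)) 1
    * (1 + inverse lam) * (b_y C + \<sigma>_y C) * T *
    (g_x C * \<Gamma>1 ((2 * k_f C + 1 + f_z C) * T)
                ((2 * k_b C + 1 + \<sigma>_x C + (1 + lam) * (b_y C + \<sigma>_y C) * L) * T)
     + f_x C * T * \<Gamma>0 ((2 * k_f C + 1 + f_z C) * T)
         * \<Gamma>0 ((2 * k_b C + 1 + \<sigma>_x C + (1 + lam) * (b_y C + \<sigma>_y C) * L) * T))"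

definition c2_fun :: "real \<Rightarrow> bounds \<Rightarrow> real \<Rightarrow> real \<Rightarrow> real" where
  "c2_fun T C L G = (INF lam\<in>{0<..}. c2_at T C lam L G)"

end

theory Submission imports Defs begin

text \<open>One backward step is estimated in mean square: if \<open>q1\<close>, \<open>q2\<close> satisfy
  \<open>(q1 z1 - q2 z2)\<^sup>2 \<le> P (z1 - z2)\<^sup>2 + Q z2\<^sup>2 + R\<close>, then their images under the step satisfy a bound of the
  same form with explicitly updated \<open>P\<close>, \<open>Q\<close>, \<open>R\<close>. Since such a two-point bound can be iterated backward in
  time, no forward Euler path has to be followed over several steps, and only the first two moments
  of each Brownian increment enter. Taking \<open>q1 = q2\<close> gives Lipschitz bounds, comparing two inputs
  gives the contraction, and summing the resulting affine recursions produces \<open>L1\<close>, \<open>L2_fun\<close>,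
  \<open>c1_fun\<close> and \<open>c2_fun\<close> up to an error that vanishes with the mesh size; the strict inequalities in the
  hypotheses absorb it. The Markovian iteration then stays in an invariant set of Lipschitz families
  of linear growth and is a contraction in a quadratic norm, so its pointwise limit is the
  solution. Uniqueness holds step by step: for a Lipschitz \<open>u (Suc i)\<close> the equation for \<open>u i x\<close> is a
  scalar fixed point equation with a small contraction constant.\<close>

section \<open>Mean-square estimates for one Euler step\<close>

text \<open>The obstacle is the coupling. The forward coefficients contain the unknown function, so
  the Lipschitz bound for \<open>F \<phi>\<close> depends exponentially on that of
  \<open>\<phi>\<close>, and the estimates close on an invariant set only for an \<open>L\<close>
  with \<open>(g_x + f_x T) max (exp ((A_f + A_b + B_y L) T)) 1 \<le> L\<close>. \<open>L1\<close>
  is an explicit such \<open>L\<close>, and \<open>L0 < exp (- 1)\<close> leaves strict room in its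
  exponent. Two inputs produce different Euler steps even from the same point, so a bound on
  \<open>q1 z - q2 z\<close> alone is not reproduced by a backward step. This forces bounds at pairs
  of points: \<open>P\<close> carries the Lipschitz constant, while \<open>Q\<close> and
  \<open>R\<close> carry the distance on the diagonal, measured at the second point. Under one
  application of \<open>F\<close> the coefficients of such a distance undergo a triangular linear
  map with the single eigenvalue \<open>c2\<close>, which feeds the quadratic coefficient into the
  constant one. Powers of this Jordan block are the origin of the factor \<open>m c2^m\<close> in
  (ii). To leading order in the step size only \<open>k_b\<close> and \<open>k_f\<close> enter;
  \<open>K_ub\<close> always carries a small factor and disappears into the perturbation
  \<open>e\<close>.\<close>

locale centered_step = prob_space M for M :: "'a measure" +
  fixes N :: "'a \<Rightarrow> real" and h :: real
  assumes N_measurable [measurable]: "N \<in> borel_measurable M"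
    and N_sq_integrable: "integrable M (\<lambda>\<omega>. (N \<omega>)\<^sup>2)"
    and N_mean: "(LINT \<omega>|M. N \<omega>) = 0"
    and N_variance: "(LINT \<omega>|M. (N \<omega>)\<^sup>2) = h"
    and h_pos: "0 < h"
begin

lemma N_integrable: "integrable M N"
  using square_integrable_imp_integrable[OF N_measurable N_sq_integrable] .

lemma integrable_mult_of_squares:
  fixes Y Z :: "'a \<Rightarrow> real"
  assumes [measurable]: "Y \<in> borel_measurable M" "Z \<in> borel_measurable M"
    and "integrable M (\<lambda>\<omega>. (Y \<omega>)\<^sup>2)" "integrable M (\<lambda>\<omega>. (Z \<omega>)\<^sup>2)"
  shows "integrable M (\<lambda>\<omega>. Y \<omega> * Z \<omega>)"
proof (rule Bochner_Integration.integrable_bound)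
  show "integrable M (\<lambda>\<omega>. (Y \<omega>)\<^sup>2 + (Z \<omega>)\<^sup>2)"
    using assms by simp
  show "AE \<omega> in M. norm (Y \<omega> * Z \<omega>) \<le> norm ((Y \<omega>)\<^sup>2 + (Z \<omega>)\<^sup>2)"
  proof (rule AE_I2)
    fix \<omega>
    have "2 * \<bar>Y \<omega>\<bar> * \<bar>Z \<omega>\<bar> \<le> (Y \<omega>)\<^sup>2 + (Z \<omega>)\<^sup>2"
      using sum_squares_bound[of "\<bar>Y \<omega>\<bar>" "\<bar>Z \<omega>\<bar>"] by simp
    moreover have "0 \<le> \<bar>Y \<omega>\<bar> * \<bar>Z \<omega>\<bar>" by simp
    ultimately have "\<bar>Y \<omega>\<bar> * \<bar>Z \<omega>\<bar> \<le> (Y \<omega>)\<^sup>2 + (Z \<omega>)\<^sup>2"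
      by linarith
    then show "norm (Y \<omega> * Z \<omega>) \<le> norm ((Y \<omega>)\<^sup>2 + (Z \<omega>)\<^sup>2)"
      by (simp add: abs_mult)
  qed
qed simp

lemma integral_sq_le:
  fixes Z :: "'a \<Rightarrow> real"
  assumes "integrable M Z" "integrable M (\<lambda>\<omega>. (Z \<omega>)\<^sup>2)"
  shows "(LINT \<omega>|M. Z \<omega>)\<^sup>2 \<le> (LINT \<omega>|M. (Z \<omega>)\<^sup>2)"
  using variance_eq[OF assms] variance_positive[of Z] by simp

text \<open>The martingale increment \<open>\<psi> N\<close> is subtracted before Jensen's inequality is applied; the term
  \<open>- h \<psi>\<^sup>2\<close> gained this way pays for the dependence of \<open>F\<close> on \<open>\<psi>\<close>, and the slack \<open>\<delta>\<close> in Young's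
  inequality pays for the cross term of \<open>\<psi> N\<close> with \<open>F\<close>.\<close>

lemma drift_mean_sq_le:
  fixes Y F :: "'a \<Rightarrow> real"
  assumes [measurable]: "Y \<in> borel_measurable M" "F \<in> borel_measurable M"
    and Y2: "integrable M (\<lambda>\<omega>. (Y \<omega>)\<^sup>2)"
    and \<psi>: "\<psi> = (1 / h) * (LINT \<omega>|M. Y \<omega> * N \<omega>)"
    and FY: "\<And>\<omega>. F \<omega> * Y \<omega> \<le> kf * (Y \<omega>)\<^sup>2 + \<bar>Y \<omega>\<bar> * sqrt (a + fz * \<psi>\<^sup>2)"
    and F2: "\<And>\<omega>. (F \<omega>)\<^sup>2 \<le> a + K * (Y \<omega>)\<^sup>2 + fz * \<psi>\<^sup>2"
    and nonneg: "0 \<le> a" "0 \<le> K" "0 \<le> fz" "0 < \<delta>" "0 < s"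
    and slack: "h / s + (s + h) * fz \<le> \<delta> / (fz + \<delta>)"
  shows "(LINT \<omega>|M. Y \<omega> + F \<omega> * h)\<^sup>2
    \<le> (1 + (2 * kf + 1 + fz + \<delta> + (s + h) * K) * h) * (LINT \<omega>|M. (Y \<omega>)\<^sup>2) + (1 + s + h) * h * a"
proof -
  let ?U = "\<lambda>\<omega>. Y \<omega> - \<psi> * N \<omega> + F \<omega> * h"
  \<comment> \<open>A pointwise majorant of \<open>(?U \<omega>)\<^sup>2\<close>, built only from
    \<open>Y\<^sup>2\<close>, \<open>Y N\<close>, \<open>N\<^sup>2\<close> and constants. It gives
    integrability of the square as well as a bound whose integral is explicit.\<close>
  let ?R = "\<lambda>\<omega>. (1 + (2 * kf + 1 + fz + \<delta> + (s + h) * K) * h) * (Y \<omega>)\<^sup>2 - 2 * \<psi> * (Y \<omega> * N \<omega>)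
    + (\<psi>\<^sup>2 * (1 + h / s)) * (N \<omega>)\<^sup>2
    + (h * (a + fz / (fz + \<delta>) * \<psi>\<^sup>2) + (s + h) * h * (a + fz * \<psi>\<^sup>2))"
  have YN: "integrable M (\<lambda>\<omega>. Y \<omega> * N \<omega>)"
    by (rule integrable_mult_of_squares) (use Y2 N_sq_integrable in auto)
  have Y1: "integrable M Y" using square_integrable_imp_integrable[OF _ Y2] by simp
  have Fsq: "integrable M (\<lambda>\<omega>. (F \<omega>)\<^sup>2)"
    by (rule Bochner_Integration.integrable_bound[of M "\<lambda>\<omega>. a + K * (Y \<omega>)\<^sup>2 + fz * \<psi>\<^sup>2"])
       (use Y2 F2 nonneg in \<open>auto intro!: AE_I2 simp: abs_of_nonneg\<close>)
  have F1: "integrable M F" using square_integrable_imp_integrable[OF _ Fsq] by simp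
  have R: "integrable M ?R"
    using YN Y2 N_sq_integrable by simp
  have UR: "(?U \<omega>)\<^sup>2 \<le> ?R \<omega>" for \<omega>
  proof -
    let ?y = "\<bar>Y \<omega>\<bar>" and ?p = "\<bar>\<psi>\<bar>"
    have "sqrt (a + fz * \<psi>\<^sup>2) \<le> sqrt a + sqrt fz * ?p"
      using sqrt_add_le_add_sqrt[of a "fz * \<psi>\<^sup>2"] nonneg by (simp add: real_sqrt_mult)
    then have "?y * sqrt (a + fz * \<psi>\<^sup>2) \<le> ?y * (sqrt a + sqrt fz * ?p)"
      by (rule mult_left_mono) simp
    moreover have "2 * ?y * sqrt a \<le> (Y \<omega>)\<^sup>2 + a"
      using sum_squares_bound[of ?y "sqrt a"] nonneg by simp
    \<comment> \<open>The weight \<open>fz + \<delta>\<close> instead of \<open>fz\<close> also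
      covers \<open>fz = 0\<close> and leaves a coefficient of \<open>\<psi>\<^sup>2\<close>
      strictly below 1, so that part of the gain \<open>- h \<psi>\<^sup>2\<close> remains for the
      other error terms.\<close>
    moreover have "2 * ?y * (sqrt fz * ?p) \<le> (fz + \<delta>) * (Y \<omega>)\<^sup>2 + fz / (fz + \<delta>) * \<psi>\<^sup>2"
    proof -
      have "2 * (sqrt (fz + \<delta>) * ?y) * (sqrt fz / sqrt (fz + \<delta>) * ?p)
          \<le> (sqrt (fz + \<delta>) * ?y)\<^sup>2 + (sqrt fz / sqrt (fz + \<delta>) * ?p)\<^sup>2"
        by (rule sum_squares_bound)
      then show ?thesis using nonneg by (simp add: power_mult_distrib power_divide mult_ac)
    qed
    ultimately have A: "2 * (F \<omega> * Y \<omega>) \<le> (2 * kf + 1 + fz + \<delta>) * (Y \<omega>)\<^sup>2 + a + fz / (fz + \<delta>) * \<psi>\<^sup>2"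
      using FY[of \<omega>] by (simp add: algebra_simps)
    have "0 \<le> (\<psi> * N \<omega> / sqrt s + F \<omega> * sqrt s)\<^sup>2" by simp
    also have "\<dots> = \<psi>\<^sup>2 * (N \<omega>)\<^sup>2 / s + s * (F \<omega>)\<^sup>2 + 2 * (\<psi> * N \<omega> * F \<omega>)"
      using nonneg by (simp add: power2_sum power_mult_distrib power_divide)
    finally have B: "- 2 * (\<psi> * N \<omega> * F \<omega>) \<le> \<psi>\<^sup>2 * (N \<omega>)\<^sup>2 / s + s * (F \<omega>)\<^sup>2" by simp
    have E: "(s + h) * (F \<omega>)\<^sup>2 \<le> (s + h) * (a + K * (Y \<omega>)\<^sup>2 + fz * \<psi>\<^sup>2)"
      using F2[of \<omega>] nonneg h_pos by (intro mult_left_mono) auto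
    have "(?U \<omega>)\<^sup>2 = (Y \<omega>)\<^sup>2 - 2 * \<psi> * (Y \<omega> * N \<omega>) + \<psi>\<^sup>2 * (N \<omega>)\<^sup>2
        + h * (2 * (F \<omega> * Y \<omega>) + (- 2 * (\<psi> * N \<omega> * F \<omega>)) + h * (F \<omega>)\<^sup>2)"
      by (simp add: power2_eq_square algebra_simps)
    also have "\<dots> \<le> (Y \<omega>)\<^sup>2 - 2 * \<psi> * (Y \<omega> * N \<omega>) + \<psi>\<^sup>2 * (N \<omega>)\<^sup>2
        + h * ((2 * kf + 1 + fz + \<delta>) * (Y \<omega>)\<^sup>2 + a + fz / (fz + \<delta>) * \<psi>\<^sup>2
          + \<psi>\<^sup>2 * (N \<omega>)\<^sup>2 / s + (s + h) * (a + K * (Y \<omega>)\<^sup>2 + fz * \<psi>\<^sup>2))"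
      using A B E h_pos by (intro add_left_mono mult_left_mono) (auto simp: algebra_simps)
    also have "\<dots> = ?R \<omega>"
      by (simp add: algebra_simps)
    finally show ?thesis .
  qed
  have Um: "integrable M (\<lambda>\<omega>. (?U \<omega>)\<^sup>2)"
  proof (rule Bochner_Integration.integrable_bound[OF R])
    show "AE \<omega> in M. norm ((?U \<omega>)\<^sup>2) \<le> norm (?R \<omega>)"
    proof (rule AE_I2)
      fix \<omega>
      show "norm ((?U \<omega>)\<^sup>2) \<le> norm (?R \<omega>)"
        using order_trans[OF UR abs_ge_self, of \<omega>] by (simp only: real_norm_def abs_power2)
    qed
  qed simp
  have U1: "integrable M ?U" using Y1 F1 N_integrable by simp
  have "(LINT \<omega>|M. Y \<omega> + F \<omega> * h) = (LINT \<omega>|M. ?U \<omega>)"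
    using Y1 F1 N_integrable N_mean by simp
  also have "(LINT \<omega>|M. ?U \<omega>)\<^sup>2 \<le> (LINT \<omega>|M. (?U \<omega>)\<^sup>2)"
    by (rule integral_sq_le[OF U1 Um])
  also have "\<dots> \<le> (LINT \<omega>|M. ?R \<omega>)"
    by (rule integral_mono[OF Um R UR])
  \<comment> \<open>Here the gain appears: \<open>Y N\<close> has mean \<open>\<psi> h\<close> and
    \<open>N\<^sup>2\<close> has mean \<open>h\<close>, so \<open>- 2 \<psi> (\<psi> h) +
    \<psi>\<^sup>2 h = - h \<psi>\<^sup>2\<close>.\<close>
  also have "\<dots> = (1 + (2 * kf + 1 + fz + \<delta> + (s + h) * K) * h) * (LINT \<omega>|M. (Y \<omega>)\<^sup>2)
      - 2 * \<psi> * (\<psi> * h) + (\<psi>\<^sup>2 * (1 + h / s)) * h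
      + (h * (a + fz / (fz + \<delta>) * \<psi>\<^sup>2) + (s + h) * h * (a + fz * \<psi>\<^sup>2))"
    using YN Y2 N_sq_integrable h_pos by (simp add: N_variance \<psi> prob_space)
  also have "\<dots> = (1 + (2 * kf + 1 + fz + \<delta> + (s + h) * K) * h) * (LINT \<omega>|M. (Y \<omega>)\<^sup>2)
      + (1 + s + h) * h * a + h * \<psi>\<^sup>2 * (h / s + (s + h) * fz - (1 - fz / (fz + \<delta>)))"
    by (simp add: power2_eq_square algebra_simps)
  also have "1 - fz / (fz + \<delta>) = \<delta> / (fz + \<delta>)"
    using nonneg by (simp add: field_simps)
  also have "h * \<psi>\<^sup>2 * (h / s + (s + h) * fz - \<delta> / (fz + \<delta>)) \<le> 0"
    using slack h_pos by (intro mult_nonneg_nonpos) auto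
  finally show ?thesis by simp
qed

lemma affine_sq:
  shows "integrable M (\<lambda>\<omega>. (m + s * N \<omega>)\<^sup>2)"
    and "(LINT \<omega>|M. (m + s * N \<omega>)\<^sup>2) = m\<^sup>2 + s\<^sup>2 * h"
proof -
  have *: "(\<lambda>\<omega>. (m + s * N \<omega>)\<^sup>2) = (\<lambda>\<omega>. m\<^sup>2 + (2 * m * s) * N \<omega> + s\<^sup>2 * (N \<omega>)\<^sup>2)"
    by (rule ext) (simp add: power2_eq_square algebra_simps)
  show "integrable M (\<lambda>\<omega>. (m + s * N \<omega>)\<^sup>2)"
    unfolding * using N_integrable N_sq_integrable by simp
  show "(LINT \<omega>|M. (m + s * N \<omega>)\<^sup>2) = m\<^sup>2 + s\<^sup>2 * h"
    unfolding * using N_integrable N_sq_integrable by (simp add: N_mean N_variance prob_space)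
qed

end

section \<open>One Euler step with coefficients frozen in time\<close>

definition A_f :: "bounds \<Rightarrow> real" where
  "A_f C = 2 * k_f C + 1 + f_z C"

text \<open>\<open>A_f\<close> and \<open>A_b\<close> are the exponential rates of the second
  moments of the backward value and of the forward step; the summand 1 in each comes from Young's
  inequality. \<open>B_y\<close> weighs the feedback of the inserted value, \<open>B_0\<close> the
  constant part of the growth.\<close>

definition A_b :: "bounds \<Rightarrow> real" where
  "A_b C = 2 * k_b C + 1 + \<sigma>_x C"

definition B_y :: "bounds \<Rightarrow> real" where
  "B_y C = b_y C + \<sigma>_y C"

definition B_0 :: "bounds \<Rightarrow> real" where
  "B_0 C = b_0 C + \<sigma>_0 C"

text \<open>The numbers \<open>\<delta>\<close> and \<open>s\<close> are those of \<open>drift_mean_sq_le\<close>; \<open>e\<close> is the resulting perturbation of the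
  constants of the continuous-time estimates.\<close>

definition small_step :: "bounds \<Rightarrow> real \<Rightarrow> real \<Rightarrow> bool" where
  "small_step C e h \<longleftrightarrow> 0 < e \<and> 0 < h \<and> h \<le> e \<and> K_ub C * h \<le> e \<and> 0 \<le> 1 + (A_f C + e) * h \<and>
    (\<exists>\<delta>>0. \<exists>s>0. h / s + (s + h) * f_z C \<le> \<delta> / (f_z C + \<delta>) \<and> \<delta> + (s + h) * K_ub C \<le> e \<and> s + h \<le> e)"

definition quadratic_growth :: "(real \<Rightarrow> real) \<Rightarrow> bool" where
  "quadratic_growth q \<longleftrightarrow> q \<in> borel_measurable borel \<and> (\<exists>G H. \<forall>x. (q x)\<^sup>2 \<le> G * x\<^sup>2 + H)"

lemma abs_le_sqrt_of_sq_le: "\<bar>d\<bar> \<le> sqrt r" if "d\<^sup>2 \<le> r" for d r :: real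
  using real_sqrt_le_mono[OF that] by simp

lemma quadratic_growth_of_lipschitz:
  fixes q :: "real \<Rightarrow> real"
  assumes "0 \<le> L" and L: "\<And>x y. (q x - q y)\<^sup>2 \<le> L * (x - y)\<^sup>2"
  shows "quadratic_growth q"
  unfolding quadratic_growth_def
proof (intro conjI exI allI)
  have "\<bar>q x - q y\<bar> \<le> sqrt L * \<bar>x - y\<bar>" for x y
    using real_sqrt_le_mono[OF L[of x y]] by (simp add: real_sqrt_mult)
  then have "(sqrt L)-lipschitz_on UNIV q"
    by (intro lipschitz_onI) (auto simp: dist_real_def assms(1))
  then show "q \<in> borel_measurable borel"
    by (intro borel_measurable_continuous_onI lipschitz_on_continuous_on)
  show "(q x)\<^sup>2 \<le> 2 * L * x\<^sup>2 + 2 * (q 0)\<^sup>2" for x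
  proof -
    have "0 \<le> (q x - 2 * q 0)\<^sup>2" by simp
    then have "(q x)\<^sup>2 \<le> 2 * (q x - q 0)\<^sup>2 + 2 * (q 0)\<^sup>2"
      by (simp add: power2_eq_square algebra_simps)
    then show ?thesis using L[of x 0] by simp
  qed
qed

text \<open>In a step from a deterministic point, \<open>b\<close> and \<open>\<sigma>\<close> are
  constants and only the \<open>y\<close> argument of \<open>f\<close> is random; the Lipschitz
  bound in \<open>y\<close> supplies its measurability.\<close>

locale coefficient_slice =
  fixes C :: bounds and b \<sigma> :: "real \<Rightarrow> real \<Rightarrow> real" and f :: "real \<Rightarrow> real \<Rightarrow> real \<Rightarrow> real"
  assumes bounds_nonneg: "0 \<le> K_ub C" "0 \<le> b_y C" "0 \<le> \<sigma>_x C" "0 \<le> \<sigma>_y C" "0 \<le> f_x C" "0 \<le> f_z C"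
      "0 \<le> b_0 C" "0 \<le> \<sigma>_0 C" "0 \<le> f_0 C"
    and b_mono: "(b x1 y - b x2 y) * (x1 - x2) \<le> k_b C * (x1 - x2)\<^sup>2"
    and f_mono: "(f x y1 z - f x y2 z) * (y1 - y2) \<le> k_f C * (y1 - y2)\<^sup>2"
    and b_diff: "(b x1 y1 - b x2 y2)\<^sup>2 \<le> K_ub C * (x1 - x2)\<^sup>2 + b_y C * (y1 - y2)\<^sup>2"
    and \<sigma>_diff: "(\<sigma> x1 y1 - \<sigma> x2 y2)\<^sup>2 \<le> \<sigma>_x C * (x1 - x2)\<^sup>2 + \<sigma>_y C * (y1 - y2)\<^sup>2"
    and f_diff: "(f x1 y1 z1 - f x2 y2 z2)\<^sup>2
        \<le> f_x C * (x1 - x2)\<^sup>2 + K_ub C * (y1 - y2)\<^sup>2 + f_z C * (z1 - z2)\<^sup>2"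
    and b_growth: "(b x y)\<^sup>2 \<le> b_0 C + K_ub C * x\<^sup>2 + b_y C * y\<^sup>2"
    and \<sigma>_growth: "(\<sigma> x y)\<^sup>2 \<le> \<sigma>_0 C + \<sigma>_x C * x\<^sup>2 + \<sigma>_y C * y\<^sup>2"
    and f_growth: "(f x y z)\<^sup>2 \<le> f_0 C + f_x C * x\<^sup>2 + K_ub C * y\<^sup>2 + f_z C * z\<^sup>2"
begin

lemma f_measurable [measurable]: "(\<lambda>y. f x y z) \<in> borel_measurable borel"
proof (rule borel_measurable_continuous_onI)
  have "\<bar>f x y1 z - f x y2 z\<bar> \<le> sqrt (K_ub C) * \<bar>y1 - y2\<bar>" for y1 y2
    using real_sqrt_le_mono[OF f_diff[of x y1 z x y2 z]] by (simp add: real_sqrt_mult)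
  then have "(sqrt (K_ub C))-lipschitz_on UNIV (\<lambda>y. f x y z)"
    by (intro lipschitz_onI) (auto simp: dist_real_def bounds_nonneg)
  then show "continuous_on UNIV (\<lambda>y. f x y z)"
    by (rule lipschitz_on_continuous_on)
qed

end

locale euler_step = centered_step M N h + coefficient_slice C b \<sigma> f
  for M :: "'a measure" and N h C b \<sigma> f +
  fixes e :: real
  assumes small: "small_step C e h"
begin

definition X :: "real \<Rightarrow> real \<Rightarrow> 'a \<Rightarrow> real" where
  "X y x \<omega> = x + b x y * h + \<sigma> x y * N \<omega>"

definition \<psi> :: "real \<Rightarrow> (real \<Rightarrow> real) \<Rightarrow> real \<Rightarrow> real" where
  "\<psi> y q x = (1 / h) * (LINT \<omega>|M. q (X y x \<omega>) * N \<omega>)"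

text \<open>The number \<open>y\<close> stands for \<open>p x\<close>: a step sees the inserted
  function only through this value. The estimates can therefore treat it as a free parameter, and
  the implicit equation of (R) is scalar.\<close>

definition V :: "real \<Rightarrow> (real \<Rightarrow> real) \<Rightarrow> real \<Rightarrow> real" where
  "V y q x = (LINT \<omega>|M. q (X y x \<omega>) + f x (q (X y x \<omega>)) (\<psi> y q x) * h)"

lemma X_measurable [measurable]: "X y x \<in> borel_measurable M"
  unfolding X_def by measurable

lemma e_pos: "0 < e" and h_le: "h \<le> e" and Kh_le: "K_ub C * h \<le> e"
  using small by (auto simp: small_step_def)

text \<open>Passing from \<open>b x1 y1\<close> to \<open>b x2 y2\<close> through
  \<open>b x2 y1\<close> uses monotonicity for the change of \<open>x\<close> and Young's inequality
  for the change of \<open>y\<close>. The squared drift has an extra factor \<open>h\<close>, so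
  \<open>K_ub\<close> is absorbed by \<open>e\<close>.\<close>

lemma X_diff:
  shows "integrable M (\<lambda>\<omega>. (X y1 x1 \<omega> - X y2 x2 \<omega>)\<^sup>2)"
    and "(LINT \<omega>|M. (X y1 x1 \<omega> - X y2 x2 \<omega>)\<^sup>2)
      \<le> (1 + (A_b C + e) * h) * (x1 - x2)\<^sup>2 + (1 + e) * B_y C * h * (y1 - y2)\<^sup>2"
proof -
  let ?\<beta> = "b x1 y1 - b x2 y2" and ?s = "\<sigma> x1 y1 - \<sigma> x2 y2"
  have *: "X y1 x1 \<omega> - X y2 x2 \<omega> = ((x1 - x2) + ?\<beta> * h) + ?s * N \<omega>" for \<omega>
    by (simp add: X_def algebra_simps)
  show "integrable M (\<lambda>\<omega>. (X y1 x1 \<omega> - X y2 x2 \<omega>)\<^sup>2)"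
    unfolding * by (rule affine_sq)
  have 1: "2 * (?\<beta> * (x1 - x2)) \<le> (2 * k_b C + 1) * (x1 - x2)\<^sup>2 + b_y C * (y1 - y2)\<^sup>2"
  proof -
    have "2 * (b x2 y1 - b x2 y2) * (x1 - x2) \<le> (b x2 y1 - b x2 y2)\<^sup>2 + (x1 - x2)\<^sup>2"
      by (rule sum_squares_bound)
    also have "(b x2 y1 - b x2 y2)\<^sup>2 \<le> b_y C * (y1 - y2)\<^sup>2"
      using b_diff[of x2 y1 x2 y2] by simp
    finally show ?thesis using b_mono[of x1 y1 x2] by (simp add: algebra_simps)
  qed
  have 2: "h * ?\<beta>\<^sup>2 \<le> e * (x1 - x2)\<^sup>2 + e * b_y C * (y1 - y2)\<^sup>2"
  proof -
    have "h * ?\<beta>\<^sup>2 \<le> h * (K_ub C * (x1 - x2)\<^sup>2 + b_y C * (y1 - y2)\<^sup>2)"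
      using h_pos by (intro mult_left_mono b_diff) simp
    also have "\<dots> = (K_ub C * h) * (x1 - x2)\<^sup>2 + h * (b_y C * (y1 - y2)\<^sup>2)"
      by (simp add: algebra_simps)
    also have "\<dots> \<le> e * (x1 - x2)\<^sup>2 + e * (b_y C * (y1 - y2)\<^sup>2)"
      using h_le Kh_le bounds_nonneg by (intro add_mono mult_right_mono) auto
    finally show ?thesis by (simp add: mult_ac)
  qed
  have 3: "0 \<le> e * \<sigma>_y C * (y1 - y2)\<^sup>2"
    using e_pos bounds_nonneg by simp
  have "(LINT \<omega>|M. (X y1 x1 \<omega> - X y2 x2 \<omega>)\<^sup>2) = ((x1 - x2) + ?\<beta> * h)\<^sup>2 + ?s\<^sup>2 * h"
    unfolding * by (rule affine_sq)
  also have "\<dots> = (x1 - x2)\<^sup>2 + h * (2 * (?\<beta> * (x1 - x2)) + h * ?\<beta>\<^sup>2 + ?s\<^sup>2)"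
    by (simp add: power2_eq_square algebra_simps)
  also have "\<dots> \<le> (x1 - x2)\<^sup>2 + h * ((A_b C + e) * (x1 - x2)\<^sup>2 + (1 + e) * B_y C * (y1 - y2)\<^sup>2)"
    using 1 2 3 \<sigma>_diff[of x1 y1 x2 y2] h_pos unfolding A_b_def B_y_def
    by (intro add_left_mono mult_left_mono) (auto simp: algebra_simps)
  finally show "(LINT \<omega>|M. (X y1 x1 \<omega> - X y2 x2 \<omega>)\<^sup>2)
      \<le> (1 + (A_b C + e) * h) * (x1 - x2)\<^sup>2 + (1 + e) * B_y C * h * (y1 - y2)\<^sup>2"
    by (simp add: algebra_simps)
qed

text \<open>The same expansion with the origin as second point, where \<open>b 0 y\<close> is
  controlled by the growth condition; this is the source of \<open>B_0\<close>.\<close>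

lemma X_sq:
  shows "integrable M (\<lambda>\<omega>. (X y x \<omega>)\<^sup>2)"
    and "(LINT \<omega>|M. (X y x \<omega>)\<^sup>2)
      \<le> (1 + (A_b C + e) * h) * x\<^sup>2 + (1 + e) * B_y C * h * y\<^sup>2 + (1 + e) * B_0 C * h"
proof -
  have *: "X y x \<omega> = (x + b x y * h) + \<sigma> x y * N \<omega>" for \<omega>
    by (simp add: X_def)
  show "integrable M (\<lambda>\<omega>. (X y x \<omega>)\<^sup>2)"
    unfolding * by (rule affine_sq)
  have 1: "2 * (b x y * x) \<le> (2 * k_b C + 1) * x\<^sup>2 + b_y C * y\<^sup>2 + b_0 C"
  proof -
    have "2 * b 0 y * x \<le> (b 0 y)\<^sup>2 + x\<^sup>2"
      by (rule sum_squares_bound)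
    also have "(b 0 y)\<^sup>2 \<le> b_0 C + b_y C * y\<^sup>2"
      using b_growth[of 0 y] by simp
    finally show ?thesis using b_mono[of x y 0] by (simp add: algebra_simps)
  qed
  have 2: "h * (b x y)\<^sup>2 \<le> e * x\<^sup>2 + e * b_y C * y\<^sup>2 + e * b_0 C"
  proof -
    have "h * (b x y)\<^sup>2 \<le> h * (b_0 C + K_ub C * x\<^sup>2 + b_y C * y\<^sup>2)"
      using h_pos by (intro mult_left_mono b_growth) simp
    also have "\<dots> = (K_ub C * h) * x\<^sup>2 + h * (b_y C * y\<^sup>2) + h * b_0 C"
      by (simp add: algebra_simps)
    also have "\<dots> \<le> e * x\<^sup>2 + e * (b_y C * y\<^sup>2) + e * b_0 C"
      using h_le Kh_le bounds_nonneg by (intro add_mono mult_right_mono) auto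
    finally show ?thesis by (simp add: mult_ac)
  qed
  have 3: "0 \<le> e * \<sigma>_y C * y\<^sup>2" "0 \<le> e * \<sigma>_0 C"
    using e_pos bounds_nonneg by simp_all
  have "(LINT \<omega>|M. (X y x \<omega>)\<^sup>2) = (x + b x y * h)\<^sup>2 + (\<sigma> x y)\<^sup>2 * h"
    unfolding * by (rule affine_sq)
  also have "\<dots> = x\<^sup>2 + h * (2 * (b x y * x) + h * (b x y)\<^sup>2 + (\<sigma> x y)\<^sup>2)"
    by (simp add: power2_eq_square algebra_simps)
  also have "\<dots> \<le> x\<^sup>2 + h * ((A_b C + e) * x\<^sup>2 + (1 + e) * B_y C * y\<^sup>2 + (1 + e) * B_0 C)"
    using 1 2 3 \<sigma>_growth[of x y] h_pos unfolding A_b_def B_y_def B_0_def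
    by (intro add_left_mono mult_left_mono) (auto simp: algebra_simps)
  finally show "(LINT \<omega>|M. (X y x \<omega>)\<^sup>2)
      \<le> (1 + (A_b C + e) * h) * x\<^sup>2 + (1 + e) * B_y C * h * y\<^sup>2 + (1 + e) * B_0 C * h"
    by (simp add: algebra_simps)
qed

lemma quadratic_growth_integrable:
  assumes "quadratic_growth q"
  shows "(\<lambda>\<omega>. q (X y x \<omega>)) \<in> borel_measurable M"
    and "integrable M (\<lambda>\<omega>. (q (X y x \<omega>))\<^sup>2)"
    and "integrable M (\<lambda>\<omega>. q (X y x \<omega>))"
    and "integrable M (\<lambda>\<omega>. q (X y x \<omega>) * N \<omega>)"
    and "integrable M (\<lambda>\<omega>. f x' (q (X y x \<omega>)) z)"
proof -
  have q [measurable]: "q \<in> borel_measurable borel"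
    using assms by (simp add: quadratic_growth_def)
  show m [measurable]: "(\<lambda>\<omega>. q (X y x \<omega>)) \<in> borel_measurable M"
    by measurable
  obtain G H where GH: "\<And>x. (q x)\<^sup>2 \<le> G * x\<^sup>2 + H"
    using assms by (auto simp: quadratic_growth_def)
  show sq: "integrable M (\<lambda>\<omega>. (q (X y x \<omega>))\<^sup>2)"
  proof (rule Bochner_Integration.integrable_bound)
    show "integrable M (\<lambda>\<omega>. G * (X y x \<omega>)\<^sup>2 + H)" using X_sq by simp
    show "AE \<omega> in M. norm ((q (X y x \<omega>))\<^sup>2) \<le> norm (G * (X y x \<omega>)\<^sup>2 + H)"
      by (rule AE_I2) (use order_trans[OF GH abs_ge_self] in simp)
  qed simp
  show "integrable M (\<lambda>\<omega>. q (X y x \<omega>))"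
    by (rule square_integrable_imp_integrable[OF m sq])
  show "integrable M (\<lambda>\<omega>. q (X y x \<omega>) * N \<omega>)"
    by (rule integrable_mult_of_squares) (use sq N_sq_integrable in auto)
  have "integrable M (\<lambda>\<omega>. (f x' (q (X y x \<omega>)) z)\<^sup>2)"
  proof (rule Bochner_Integration.integrable_bound)
    show "integrable M (\<lambda>\<omega>. f_0 C + f_x C * x'\<^sup>2 + K_ub C * (q (X y x \<omega>))\<^sup>2 + f_z C * z\<^sup>2)"
      using sq by simp
    show "AE \<omega> in M. norm ((f x' (q (X y x \<omega>)) z)\<^sup>2)
        \<le> norm (f_0 C + f_x C * x'\<^sup>2 + K_ub C * (q (X y x \<omega>))\<^sup>2 + f_z C * z\<^sup>2)"
      by (rule AE_I2) (use order_trans[OF f_growth abs_ge_self] in simp)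
  qed simp
  then show "integrable M (\<lambda>\<omega>. f x' (q (X y x \<omega>)) z)"
    by (rule square_integrable_imp_integrable[rotated]) simp
qed

lemma drift_mean_sq_le_of_small_step:
  fixes Y F :: "'a \<Rightarrow> real"
  assumes "Y \<in> borel_measurable M" "F \<in> borel_measurable M" "integrable M (\<lambda>\<omega>. (Y \<omega>)\<^sup>2)"
    and "p = (1 / h) * (LINT \<omega>|M. Y \<omega> * N \<omega>)"
    and "\<And>\<omega>. F \<omega> * Y \<omega> \<le> k_f C * (Y \<omega>)\<^sup>2 + \<bar>Y \<omega>\<bar> * sqrt (a + f_z C * p\<^sup>2)"
    and "\<And>\<omega>. (F \<omega>)\<^sup>2 \<le> a + K_ub C * (Y \<omega>)\<^sup>2 + f_z C * p\<^sup>2"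
    and "0 \<le> a"
  shows "(LINT \<omega>|M. Y \<omega> + F \<omega> * h)\<^sup>2
    \<le> (1 + (A_f C + e) * h) * (LINT \<omega>|M. (Y \<omega>)\<^sup>2) + (1 + e) * h * a"
proof -
  obtain \<delta> s where ds: "0 < \<delta>" "0 < s" "h / s + (s + h) * f_z C \<le> \<delta> / (f_z C + \<delta>)"
    "\<delta> + (s + h) * K_ub C \<le> e" "s + h \<le> e"
    using small by (auto simp: small_step_def)
  have "(LINT \<omega>|M. Y \<omega> + F \<omega> * h)\<^sup>2
    \<le> (1 + (2 * k_f C + 1 + f_z C + \<delta> + (s + h) * K_ub C) * h) * (LINT \<omega>|M. (Y \<omega>)\<^sup>2) + (1 + s + h) * h * a"
    by (rule drift_mean_sq_le[OF assms(1-6)]) (use assms(7) bounds_nonneg ds in auto)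
  also have "\<dots> \<le> (1 + (A_f C + e) * h) * (LINT \<omega>|M. (Y \<omega>)\<^sup>2) + (1 + e) * h * a"
  proof (rule add_mono)
    have "2 * k_f C + 1 + f_z C + \<delta> + (s + h) * K_ub C \<le> A_f C + e"
      using ds by (simp add: A_f_def)
    then show "(1 + (2 * k_f C + 1 + f_z C + \<delta> + (s + h) * K_ub C) * h) * (LINT \<omega>|M. (Y \<omega>)\<^sup>2)
        \<le> (1 + (A_f C + e) * h) * (LINT \<omega>|M. (Y \<omega>)\<^sup>2)"
      using h_pos by (intro mult_right_mono add_left_mono) auto
    have "1 + s + h \<le> 1 + e" using ds by simp
    then show "(1 + s + h) * h * a \<le> (1 + e) * h * a"
      using h_pos assms(7) by (intro mult_right_mono) auto
  qed
  finally show ?thesis .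
qed

text \<open>The mean-square estimate is applied to the difference of the two backward values, with
  the difference of the drivers as drift. The two Euler points differ as soon as
  \<open>x1 \<noteq> x2\<close> or \<open>y1 \<noteq> y2\<close>, which is why \<open>diff\<close>
  is required at all pairs; its right-hand side is then integrated with the two moment bounds for
  \<open>X\<close>.\<close>

lemma V_diff_sq_le:
  assumes q1: "quadratic_growth q1" and q2: "quadratic_growth q2"
    and nonneg: "0 \<le> P" "0 \<le> Q"
    and diff: "\<And>z1 z2. (q1 z1 - q2 z2)\<^sup>2 \<le> P * (z1 - z2)\<^sup>2 + Q * z2\<^sup>2 + R"
  shows "(V y1 q1 x1 - V y2 q2 x2)\<^sup>2 \<le> (1 + (A_f C + e) * h) *
      (P * ((1 + (A_b C + e) * h) * (x1 - x2)\<^sup>2 + (1 + e) * B_y C * h * (y1 - y2)\<^sup>2)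
        + Q * ((1 + (A_b C + e) * h) * x2\<^sup>2 + (1 + e) * B_y C * h * y2\<^sup>2 + (1 + e) * B_0 C * h) + R)
      + (1 + e) * h * (f_x C * (x1 - x2)\<^sup>2)"
proof -
  define Y1 where "Y1 \<omega> = q1 (X y1 x1 \<omega>)" for \<omega>
  define Y2 where "Y2 \<omega> = q2 (X y2 x2 \<omega>)" for \<omega>
  define p1 where "p1 = \<psi> y1 q1 x1"
  define p2 where "p2 = \<psi> y2 q2 x2"
  define F where "F \<omega> = f x1 (Y1 \<omega>) p1 - f x2 (Y2 \<omega>) p2" for \<omega>
  note i1 = quadratic_growth_integrable[OF q1, where y = y1 and x = x1, folded Y1_def]
  note i2 = quadratic_growth_integrable[OF q2, where y = y2 and x = x2, folded Y2_def]
  note [measurable] = i1(1) i2(1)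
  have int: "integrable M (\<lambda>\<omega>. (Y1 \<omega> - Y2 \<omega>)\<^sup>2)"
  proof -
    have "integrable M (\<lambda>\<omega>. (Y1 \<omega>)\<^sup>2 + (Y2 \<omega>)\<^sup>2 - 2 * (Y1 \<omega> * Y2 \<omega>))"
      using i1(2) i2(2) integrable_mult_of_squares[OF i1(1) i2(1) i1(2) i2(2)] by simp
    then show ?thesis by (simp add: power2_diff mult.assoc)
  qed
  have "V y1 q1 x1 - V y2 q2 x2 = (LINT \<omega>|M. (Y1 \<omega> - Y2 \<omega>) + F \<omega> * h)"
    using i1(3,5) i2(3,5)
    by (simp add: V_def F_def p1_def p2_def flip: Y1_def Y2_def) (simp add: left_diff_distrib)
  also have "\<dots>\<^sup>2 \<le> (1 + (A_f C + e) * h) * (LINT \<omega>|M. (Y1 \<omega> - Y2 \<omega>)\<^sup>2) + (1 + e) * h * (f_x C * (x1 - x2)\<^sup>2)"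
  proof (rule drift_mean_sq_le_of_small_step[OF _ _ int])
    show "p1 - p2 = (1 / h) * (LINT \<omega>|M. (Y1 \<omega> - Y2 \<omega>) * N \<omega>)"
      using i1(4) i2(4) by (simp add: p1_def p2_def \<psi>_def left_diff_distrib diff_divide_distrib flip: Y1_def Y2_def)
    show "(F \<omega>)\<^sup>2 \<le> f_x C * (x1 - x2)\<^sup>2 + K_ub C * (Y1 \<omega> - Y2 \<omega>)\<^sup>2 + f_z C * (p1 - p2)\<^sup>2" for \<omega>
      unfolding F_def by (rule f_diff)
    show "F \<omega> * (Y1 \<omega> - Y2 \<omega>) \<le> k_f C * (Y1 \<omega> - Y2 \<omega>)\<^sup>2
        + \<bar>Y1 \<omega> - Y2 \<omega>\<bar> * sqrt (f_x C * (x1 - x2)\<^sup>2 + f_z C * (p1 - p2)\<^sup>2)" for \<omega>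
    proof -
      \<comment> \<open>The monotone part changes only \<open>y\<close>, and the remainder
        \<open>?d\<close> keeps \<open>y\<close> fixed, so \<open>f_diff\<close> contributes no
        \<open>K_ub\<close> term here.\<close>
      let ?d = "f x1 (Y2 \<omega>) p1 - f x2 (Y2 \<omega>) p2" and ?y = "Y1 \<omega> - Y2 \<omega>"
      have "\<bar>?d\<bar> \<le> sqrt (f_x C * (x1 - x2)\<^sup>2 + f_z C * (p1 - p2)\<^sup>2)"
        using f_diff[of x1 "Y2 \<omega>" p1 x2 "Y2 \<omega>" p2] by (intro abs_le_sqrt_of_sq_le) simp
      then have "\<bar>?y\<bar> * \<bar>?d\<bar> \<le> \<bar>?y\<bar> * sqrt (f_x C * (x1 - x2)\<^sup>2 + f_z C * (p1 - p2)\<^sup>2)"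
        by (rule mult_left_mono) simp
      moreover have "?d * ?y \<le> \<bar>?y\<bar> * \<bar>?d\<bar>"
        by (metis abs_ge_self abs_mult mult.commute)
      moreover have "F \<omega> * ?y = (f x1 (Y1 \<omega>) p1 - f x1 (Y2 \<omega>) p1) * ?y + ?d * ?y"
        by (simp add: F_def algebra_simps)
      ultimately show ?thesis using f_mono[of x1 "Y1 \<omega>" p1 "Y2 \<omega>"] by linarith
    qed
  qed (use bounds_nonneg in \<open>auto simp: F_def\<close>)
  also have "(LINT \<omega>|M. (Y1 \<omega> - Y2 \<omega>)\<^sup>2)
      \<le> (LINT \<omega>|M. P * (X y1 x1 \<omega> - X y2 x2 \<omega>)\<^sup>2 + Q * (X y2 x2 \<omega>)\<^sup>2 + R)"
    using X_diff(1) X_sq(1) by (intro integral_mono int) (auto simp: Y1_def Y2_def diff)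
  also have "\<dots> = P * (LINT \<omega>|M. (X y1 x1 \<omega> - X y2 x2 \<omega>)\<^sup>2) + Q * (LINT \<omega>|M. (X y2 x2 \<omega>)\<^sup>2) + R"
    using X_diff(1) X_sq(1) by (simp add: prob_space)
  also have "\<dots> \<le> P * ((1 + (A_b C + e) * h) * (x1 - x2)\<^sup>2 + (1 + e) * B_y C * h * (y1 - y2)\<^sup>2)
        + Q * ((1 + (A_b C + e) * h) * x2\<^sup>2 + (1 + e) * B_y C * h * y2\<^sup>2 + (1 + e) * B_0 C * h) + R"
    using nonneg by (intro add_mono mult_left_mono X_diff X_sq) auto
  finally show ?thesis
    using small by (simp add: small_step_def mult_left_mono)
qed

lemma V_sq_le:
  assumes q: "quadratic_growth q" and nonneg: "0 \<le> G"
    and growth: "\<And>z. (q z)\<^sup>2 \<le> G * z\<^sup>2 + H"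
  shows "(V y q x)\<^sup>2 \<le> (1 + (A_f C + e) * h) *
      (G * ((1 + (A_b C + e) * h) * x\<^sup>2 + (1 + e) * B_y C * h * y\<^sup>2 + (1 + e) * B_0 C * h) + H)
      + (1 + e) * h * (f_0 C + f_x C * x\<^sup>2)"
proof -
  define Y where "Y \<omega> = q (X y x \<omega>)" for \<omega>
  define p where "p = \<psi> y q x"
  define F where "F \<omega> = f x (Y \<omega>) p" for \<omega>
  note i = quadratic_growth_integrable[OF q, where y = y and x = x, folded Y_def]
  note [measurable] = i(1)
  have "V y q x = (LINT \<omega>|M. Y \<omega> + F \<omega> * h)"
    by (simp add: V_def F_def p_def flip: Y_def)
  also have "\<dots>\<^sup>2 \<le> (1 + (A_f C + e) * h) * (LINT \<omega>|M. (Y \<omega>)\<^sup>2) + (1 + e) * h * (f_0 C + f_x C * x\<^sup>2)"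
  proof (rule drift_mean_sq_le_of_small_step[OF _ _ i(2)])
    show "p = (1 / h) * (LINT \<omega>|M. Y \<omega> * N \<omega>)"
      by (simp add: p_def \<psi>_def flip: Y_def)
    show "(F \<omega>)\<^sup>2 \<le> f_0 C + f_x C * x\<^sup>2 + K_ub C * (Y \<omega>)\<^sup>2 + f_z C * p\<^sup>2" for \<omega>
      unfolding F_def by (rule f_growth)
    show "F \<omega> * Y \<omega> \<le> k_f C * (Y \<omega>)\<^sup>2 + \<bar>Y \<omega>\<bar> * sqrt (f_0 C + f_x C * x\<^sup>2 + f_z C * p\<^sup>2)" for \<omega>
    proof -
      let ?d = "f x 0 p"
      have "\<bar>?d\<bar> \<le> sqrt (f_0 C + f_x C * x\<^sup>2 + f_z C * p\<^sup>2)"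
        using f_growth[of x 0 p] by (intro abs_le_sqrt_of_sq_le) simp
      then have "\<bar>Y \<omega>\<bar> * \<bar>?d\<bar> \<le> \<bar>Y \<omega>\<bar> * sqrt (f_0 C + f_x C * x\<^sup>2 + f_z C * p\<^sup>2)"
        by (rule mult_left_mono) simp
      moreover have "?d * Y \<omega> \<le> \<bar>Y \<omega>\<bar> * \<bar>?d\<bar>"
        by (metis abs_ge_self abs_mult mult.commute)
      moreover have "F \<omega> * Y \<omega> = (f x (Y \<omega>) p - f x 0 p) * Y \<omega> + ?d * Y \<omega>"
        by (simp add: F_def algebra_simps)
      ultimately show ?thesis using f_mono[of x "Y \<omega>" p 0] by simp
    qed
  qed (use bounds_nonneg in \<open>auto simp: F_def\<close>)
  also have "(LINT \<omega>|M. (Y \<omega>)\<^sup>2) \<le> (LINT \<omega>|M. G * (X y x \<omega>)\<^sup>2 + H)"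
    using X_sq(1) by (intro integral_mono i(2)) (auto simp: Y_def growth)
  also have "\<dots> = G * (LINT \<omega>|M. (X y x \<omega>)\<^sup>2) + H"
    using X_sq(1) by (simp add: prob_space)
  also have "\<dots> \<le> G * ((1 + (A_b C + e) * h) * x\<^sup>2 + (1 + e) * B_y C * h * y\<^sup>2 + (1 + e) * B_0 C * h) + H"
    using nonneg by (intro add_mono mult_left_mono X_sq) auto
  finally show ?thesis
    using small by (simp add: small_step_def mult_left_mono)
qed

end

text \<open>The order of choice matters: \<open>\<delta>\<close> is a fraction of \<open>e\<close>,
  then \<open>s\<close> is small relative to \<open>\<delta>\<close>, and \<open>h\<close> comes
  last because \<open>h / s\<close> has to vanish.\<close>

lemma eventually_small_step:
  assumes "0 \<le> K_ub C" "0 \<le> f_z C" "0 < e"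
  shows "\<forall>\<^sub>F h in at_right 0. small_step C e h"
proof -
  define \<delta> where "\<delta> = e / 2"
  define r where "r = \<delta> / (f_z C + \<delta>)"
  have \<delta>: "0 < \<delta>" and r: "0 < r" using assms by (auto simp: \<delta>_def r_def)
  have "\<forall>\<^sub>F s in at_right 0. s * f_z C < r" "\<forall>\<^sub>F s in at_right 0. \<delta> + s * K_ub C < e"
      "\<forall>\<^sub>F s in at_right 0. s < e" "\<forall>\<^sub>F s in at_right (0::real). 0 < s"
    using assms r by (real_asymp simp: \<delta>_def)+
  then have "\<forall>\<^sub>F s in at_right 0. s * f_z C < r \<and> \<delta> + s * K_ub C < e \<and> s < e \<and> 0 < s"
    by eventually_elim auto
  then obtain s where s: "s * f_z C < r" "\<delta> + s * K_ub C < e" "s < e" "0 < s"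
    using eventually_happens'[OF trivial_limit_at_right_real] by blast
  have "((\<lambda>h. h / s + (s + h) * f_z C) \<longlongrightarrow> 0 / s + (s + 0) * f_z C) (at_right 0)"
    "((\<lambda>h. \<delta> + (s + h) * K_ub C) \<longlongrightarrow> \<delta> + (s + 0) * K_ub C) (at_right 0)"
    "((\<lambda>h. s + h) \<longlongrightarrow> s + 0) (at_right 0)"
    "((\<lambda>h. 1 + (A_f C + e) * h) \<longlongrightarrow> 1 + (A_f C + e) * 0) (at_right 0)"
    "((\<lambda>h. K_ub C * h) \<longlongrightarrow> K_ub C * 0) (at_right 0)"
    using s(4) by (intro tendsto_intros; simp)+
  note lims = this
  have "\<forall>\<^sub>F h in at_right 0. h / s + (s + h) * f_z C < r"
    by (rule order_tendstoD(2)[OF lims(1)]) (use s in simp)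
  moreover have "\<forall>\<^sub>F h in at_right 0. \<delta> + (s + h) * K_ub C < e"
    by (rule order_tendstoD(2)[OF lims(2)]) (use s in simp)
  moreover have "\<forall>\<^sub>F h in at_right 0. s + h < e"
    by (rule order_tendstoD(2)[OF lims(3)]) (use s in simp)
  moreover have "\<forall>\<^sub>F h in at_right 0. 0 < 1 + (A_f C + e) * h"
    by (rule order_tendstoD(1)[OF lims(4)]) simp
  moreover have "\<forall>\<^sub>F h in at_right 0. K_ub C * h < e"
    by (rule order_tendstoD(2)[OF lims(5)]) (use assms in simp)
  moreover have "\<forall>\<^sub>F h in at_right (0::real). 0 < h"
    by (rule eventually_at_right_less)
  ultimately show ?thesis
  proof eventually_elim
    case (elim h)
    show ?case unfolding small_step_def
      using elim \<delta> s assms(3) by (intro conjI exI[of _ \<delta>] exI[of _ s]) (auto simp: r_def)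
  qed
qed

section \<open>The functions \<open>\<Gamma>0\<close> and \<open>\<Gamma>1\<close> and their discrete counterparts\<close>

text \<open>The integral form removes the case distinction at 0 and reduces comparisons of
  \<open>\<Gamma>0\<close> to pointwise comparisons of exponentials.\<close>

lemma \<Gamma>0_has_integral: "((\<lambda>s. exp (s * y)) has_integral \<Gamma>0 y) {0..1}"
proof (cases "y = 0")
  case True
  then show ?thesis using has_integral_const_real[of "1::real" 0 1] by (simp add: \<Gamma>0_def)
next
  case False
  have "((\<lambda>s. exp (s * y)) has_integral exp (1 * y) / y - exp (0 * y) / y) {0..1}"
    by (rule fundamental_theorem_of_calculus)
       (use False in \<open>auto intro!: derivative_eq_intros simp flip: has_real_derivative_iff_has_vector_derivative\<close>)
  then show ?thesis using False by (simp add: \<Gamma>0_def diff_divide_distrib)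
qed

text \<open>A multiplicative form of continuity. With \<open>y' = 0\<close> it also yields
  positivity and the upper bound for \<open>1 / \<Gamma>0\<close>.\<close>

lemma \<Gamma>0_shift_le:
  assumes "\<bar>y' - y\<bar> \<le> d"
  shows "\<Gamma>0 y' \<le> exp d * \<Gamma>0 y"
proof (rule has_integral_le)
  show "((\<lambda>s. exp (s * y')) has_integral \<Gamma>0 y') {0..1}"
    by (rule \<Gamma>0_has_integral)
  show "((\<lambda>s. exp d * exp (s * y)) has_integral exp d * \<Gamma>0 y) {0..1}"
    by (rule has_integral_mult_right[OF \<Gamma>0_has_integral])
  fix s :: real assume "s \<in> {0..1}"
  then have "\<bar>s * (y' - y)\<bar> \<le> 1 * d"
    using assms unfolding abs_mult by (intro mult_mono) auto
  then have "s * y' \<le> d + s * y" by (simp add: algebra_simps)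
  then show "exp (s * y') \<le> exp d * exp (s * y)" by (simp flip: exp_add)
qed

lemma \<Gamma>0_pos: "0 < \<Gamma>0 y"
proof -
  have "1 \<le> exp \<bar>y\<bar> * \<Gamma>0 y"
    using \<Gamma>0_shift_le[of 0 y "\<bar>y\<bar>"] by (simp add: \<Gamma>0_def[of 0])
  then have "0 < exp \<bar>y\<bar> * \<Gamma>0 y" by linarith
  then show ?thesis by (simp add: zero_less_mult_iff)
qed

lemma inverse_\<Gamma>0_le: "1 / \<Gamma>0 y \<le> exp \<bar>y\<bar>"
  using \<Gamma>0_shift_le[of 0 y "\<bar>y\<bar>"] \<Gamma>0_pos[of y] by (simp add: \<Gamma>0_def[of 0] field_simps)

text \<open>The geometric sum is its continuous-time value divided by \<open>\<Gamma>0 y\<close>. In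
  the applications \<open>y\<close> is a rate times \<open>h\<close>, so
  \<open>1 / \<Gamma>0 y\<close> is the whole discretization error and tends to 1.\<close>

lemma sum_exp_eq: "(\<Sum>j<k. exp (y * real j)) = real k * \<Gamma>0 (real k * y) / \<Gamma>0 y"
proof (cases "y = 0 \<or> k = 0")
  case True
  then show ?thesis by (auto simp: \<Gamma>0_def)
next
  case False
  have "(\<Sum>j<k. exp (y * real j)) = (\<Sum>j<k. exp y ^ j)"
    by (simp add: exp_of_nat2_mult)
  also have "\<dots> = (exp (real k * y) - 1) / (exp y - 1)"
    using False by (simp add: geometric_sum exp_of_nat_mult)
  finally show ?thesis using False by (simp add: \<Gamma>0_def)
qed

lemma \<Gamma>1_integrand_le:
  assumes "0 \<le> \<theta>'" "\<theta>' \<le> \<theta>" "\<theta> \<le> 1"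
    and "\<bar>\<theta>' * x' - \<theta> * x\<bar> \<le> d1" "\<bar>\<theta>' * y' - \<theta> * y\<bar> \<le> d2"
  shows "\<theta>' * exp (\<theta>' * x') * \<Gamma>0 (\<theta>' * y') \<le> exp (d1 + d2) * (\<theta> * exp (\<theta> * x) * \<Gamma>0 (\<theta> * y))"
proof -
  have "\<theta>' * x' \<le> d1 + \<theta> * x"
    using assms(4) by linarith
  then have "exp (\<theta>' * x') \<le> exp d1 * exp (\<theta> * x)"
    by (simp flip: exp_add)
  then have "\<theta>' * exp (\<theta>' * x') * \<Gamma>0 (\<theta>' * y') \<le> \<theta> * (exp d1 * exp (\<theta> * x)) * (exp d2 * \<Gamma>0 (\<theta> * y))"
    using assms \<Gamma>0_pos[THEN less_imp_le]
    by (intro mult_mono \<Gamma>0_shift_le mult_nonneg_nonneg) simp_all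
  then show ?thesis by (simp add: exp_add mult_ac)
qed

lemma \<Gamma>1_bdd_above: "bdd_above ((\<lambda>\<theta>. \<theta> * exp (\<theta> * x) * \<Gamma>0 (\<theta> * y)) ` {0<..<1})"
proof (rule bdd_aboveI2)
  fix \<theta> :: real assume "\<theta> \<in> {0<..<1}"
  then have *: "\<bar>\<theta> * z - 1 * 0\<bar> \<le> \<bar>z\<bar>" for z
    by (simp add: abs_mult mult_left_le_one_le)
  \<comment> \<open>The comparison point is \<open>\<theta> = 1\<close> with both rates 0, where the
    expression equals 1.\<close>
  show "\<theta> * exp (\<theta> * x) * \<Gamma>0 (\<theta> * y) \<le> exp (\<bar>x\<bar> + \<bar>y\<bar>) * (1 * exp (1 * 0) * \<Gamma>0 (1 * 0))"
    by (rule \<Gamma>1_integrand_le) (use \<open>\<theta> \<in> {0<..<1}\<close> * in auto)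
qed

lemma le_\<Gamma>1_of_less:
  assumes "0 < \<theta>" "\<theta> < 1"
  shows "\<theta> * exp (\<theta> * x) * \<Gamma>0 (\<theta> * y) \<le> \<Gamma>1 x y"
  unfolding \<Gamma>1_def by (rule cSUP_upper[OF _ \<Gamma>1_bdd_above]) (use assms in simp)

lemma \<Gamma>1_nonneg: "0 \<le> \<Gamma>1 x y"
proof -
  have "0 \<le> 1 / 2 * exp (1 / 2 * x) * \<Gamma>0 (1 / 2 * y)"
    using \<Gamma>0_pos[THEN less_imp_le] by simp
  also have "\<dots> \<le> \<Gamma>1 x y"
    by (rule le_\<Gamma>1_of_less) simp_all
  finally show ?thesis .
qed

text \<open>The supremum defining \<open>\<Gamma>1\<close> runs over the open unit interval; the right end point is reached in
  the limit.\<close>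

lemma le_\<Gamma>1:
  assumes "0 \<le> \<theta>" "\<theta> \<le> 1"
  shows "\<theta> * exp (\<theta> * x) * \<Gamma>0 (\<theta> * y) \<le> \<Gamma>1 x y"
proof (cases "\<theta> = 1")
  case True
  have "exp x * \<Gamma>0 y \<le> \<Gamma>1 x y"
  proof (rule tendsto_upperbound)
    \<comment> \<open>The factor in front tends to 1 and pays for shifting both arguments from
      \<open>t\<close> to 1, so \<open>\<Gamma>1 x y\<close> dominates it times the end point value
      for every \<open>t\<close> in the open interval.\<close>
    have "((\<lambda>t::real. t * exp (- (1 - t) * (\<bar>x\<bar> + \<bar>y\<bar>)) * (exp x * \<Gamma>0 y))
        \<longlongrightarrow> 1 * exp (- (1 - 1) * (\<bar>x\<bar> + \<bar>y\<bar>)) * (exp x * \<Gamma>0 y)) (at_left 1)"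
      by (intro tendsto_intros)
    then show "((\<lambda>t::real. t * exp (- (1 - t) * (\<bar>x\<bar> + \<bar>y\<bar>)) * (exp x * \<Gamma>0 y)) \<longlongrightarrow> exp x * \<Gamma>0 y) (at_left 1)"
      by simp
    have "\<forall>\<^sub>F t in at_left 1. t \<in> {0<..<(1::real)}"
      by (rule eventually_at_left_real) simp
    then show "\<forall>\<^sub>F t in at_left 1. t * exp (- (1 - t) * (\<bar>x\<bar> + \<bar>y\<bar>)) * (exp x * \<Gamma>0 y) \<le> \<Gamma>1 x y"
    proof eventually_elim
      case (elim t)
      have "\<Gamma>0 y \<le> exp ((1 - t) * \<bar>y\<bar>) * \<Gamma>0 (t * y)"
      proof (rule \<Gamma>0_shift_le)
        have "y - t * y = (1 - t) * y" by (simp add: algebra_simps)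
        then show "\<bar>y - t * y\<bar> \<le> (1 - t) * \<bar>y\<bar>" using elim by (simp add: abs_mult)
      qed
      moreover have "exp x \<le> exp ((1 - t) * \<bar>x\<bar>) * exp (t * x)"
      proof -
        have "(1 - t) * x \<le> (1 - t) * \<bar>x\<bar>" using elim by (intro mult_left_mono) auto
        then show ?thesis by (simp add: algebra_simps flip: exp_add)
      qed
      ultimately have "exp x * \<Gamma>0 y \<le> (exp ((1 - t) * \<bar>x\<bar>) * exp (t * x)) * (exp ((1 - t) * \<bar>y\<bar>) * \<Gamma>0 (t * y))"
        using \<Gamma>0_pos[of y] by (intro mult_mono) auto
      also have "\<dots> = exp ((1 - t) * (\<bar>x\<bar> + \<bar>y\<bar>)) * (exp (t * x) * \<Gamma>0 (t * y))"
        by (simp add: distrib_left exp_add mult_ac)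
      finally have "exp (- (1 - t) * (\<bar>x\<bar> + \<bar>y\<bar>)) * (exp x * \<Gamma>0 y)
          \<le> exp (- (1 - t) * (\<bar>x\<bar> + \<bar>y\<bar>)) * (exp ((1 - t) * (\<bar>x\<bar> + \<bar>y\<bar>)) * (exp (t * x) * \<Gamma>0 (t * y)))"
        by (rule mult_left_mono) simp
      also have "\<dots> = exp (t * x) * \<Gamma>0 (t * y)"
        unfolding mult.assoc[symmetric] exp_add[symmetric] by (simp add: left_diff_distrib)
      finally have "t * (exp (- (1 - t) * (\<bar>x\<bar> + \<bar>y\<bar>)) * (exp x * \<Gamma>0 y)) \<le> t * (exp (t * x) * \<Gamma>0 (t * y))"
        using elim by (intro mult_left_mono) auto
      also have "\<dots> \<le> \<Gamma>1 x y"
        using le_\<Gamma>1_of_less[of t x y] elim by (simp add: mult.assoc)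
      finally show ?case by (simp only: mult.assoc)
    qed
  qed simp
  then show ?thesis using True by simp
next
  case False
  then show ?thesis using assms le_\<Gamma>1_of_less[of \<theta> x y] \<Gamma>1_nonneg[of x y] by (cases "\<theta> = 0") auto
qed

lemma \<Gamma>1_shift_le:
  assumes "\<bar>x' - x\<bar> \<le> d1" "\<bar>y' - y\<bar> \<le> d2"
  shows "\<Gamma>1 x' y' \<le> exp (d1 + d2) * \<Gamma>1 x y"
  unfolding \<Gamma>1_def[of x' y']
proof (rule cSUP_least)
  fix \<theta> :: real assume \<theta>: "\<theta> \<in> {0<..<1}"
  have *: "\<bar>\<theta> * z' - \<theta> * z\<bar> \<le> d" if "\<bar>z' - z\<bar> \<le> d" for z z' d
  proof -
    have "\<bar>\<theta> * (z' - z)\<bar> \<le> 1 * d" unfolding abs_mult using \<theta> that by (intro mult_mono) auto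
    then show ?thesis by (simp add: right_diff_distrib)
  qed
  have "\<theta> * exp (\<theta> * x') * \<Gamma>0 (\<theta> * y') \<le> exp (d1 + d2) * (\<theta> * exp (\<theta> * x) * \<Gamma>0 (\<theta> * y))"
    by (rule \<Gamma>1_integrand_le) (use \<theta> * assms in auto)
  also have "\<dots> \<le> exp (d1 + d2) * \<Gamma>1 x y"
    using \<theta> le_\<Gamma>1_of_less[of \<theta> x y] by simp
  finally show "\<theta> * exp (\<theta> * x') * \<Gamma>0 (\<theta> * y') \<le> exp (d1 + d2) * \<Gamma>1 x y" .
qed simp

text \<open>The common shape of \<open>c0_fun\<close> and of the last factor of
  \<open>c2_at\<close>; they differ in the forward rate \<open>D\<close>, which is
  \<open>A_b + B_y G\<close> or \<open>A_b + B_y (1 + lam) L\<close>.\<close>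

definition kernel :: "real \<Rightarrow> real \<Rightarrow> real \<Rightarrow> real \<Rightarrow> real \<Rightarrow> real" where
  "kernel T gx fx A D = T * (gx * \<Gamma>1 (A * T) (D * T) + fx * T * \<Gamma>0 (A * T) * \<Gamma>0 (D * T))"

lemma kernel_nonneg: "0 \<le> kernel T gx fx A D" if "0 \<le> T" "0 \<le> gx" "0 \<le> fx"
  unfolding kernel_def using that \<Gamma>0_pos[THEN less_imp_le] \<Gamma>1_nonneg by simp

lemma kernel_shift_le:
  assumes "0 \<le> T" "0 \<le> gx" "0 \<le> fx" "1 \<le> c"
    and "\<bar>A' - A\<bar> \<le> d1" "\<bar>D' - D\<bar> \<le> d2"
  shows "kernel T gx (c * fx) A' D' \<le> c * exp ((d1 + d2) * T) * kernel T gx fx A D"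
proof -
  have A: "\<bar>A' * T - A * T\<bar> \<le> d1 * T" and D: "\<bar>D' * T - D * T\<bar> \<le> d2 * T"
    using assms by (simp_all add: abs_mult mult_right_mono flip: left_diff_distrib)
  have g: "gx * \<Gamma>1 (A' * T) (D' * T) \<le> c * (exp ((d1 + d2) * T) * (gx * \<Gamma>1 (A * T) (D * T)))"
  proof -
    have "gx * \<Gamma>1 (A' * T) (D' * T) \<le> gx * (exp (d1 * T + d2 * T) * \<Gamma>1 (A * T) (D * T))"
      using assms(2) by (intro mult_left_mono \<Gamma>1_shift_le A D)
    also have "\<dots> = 1 * (exp ((d1 + d2) * T) * (gx * \<Gamma>1 (A * T) (D * T)))"
      by (simp add: algebra_simps)
    also have "\<dots> \<le> c * (exp ((d1 + d2) * T) * (gx * \<Gamma>1 (A * T) (D * T)))"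
      using assms \<Gamma>1_nonneg by (intro mult_right_mono) auto
    finally show ?thesis .
  qed
  have "\<Gamma>0 (A' * T) * \<Gamma>0 (D' * T) \<le> (exp (d1 * T) * \<Gamma>0 (A * T)) * (exp (d2 * T) * \<Gamma>0 (D * T))"
    using \<Gamma>0_pos[THEN less_imp_le] by (intro mult_mono \<Gamma>0_shift_le A D) auto
  then have "(c * fx * T) * (\<Gamma>0 (A' * T) * \<Gamma>0 (D' * T))
      \<le> (c * fx * T) * ((exp (d1 * T) * \<Gamma>0 (A * T)) * (exp (d2 * T) * \<Gamma>0 (D * T)))"
    using assms by (intro mult_left_mono) auto
  then have f: "(c * fx * T) * \<Gamma>0 (A' * T) * \<Gamma>0 (D' * T)
      \<le> c * (exp ((d1 + d2) * T) * (fx * T * \<Gamma>0 (A * T) * \<Gamma>0 (D * T)))"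
    by (simp add: algebra_simps exp_add)
  have "kernel T gx (c * fx) A' D' \<le> T * (c * (exp ((d1 + d2) * T) * (gx * \<Gamma>1 (A * T) (D * T)))
      + c * (exp ((d1 + d2) * T) * (fx * T * \<Gamma>0 (A * T) * \<Gamma>0 (D * T))))"
    unfolding kernel_def using assms by (intro mult_left_mono add_mono g f) auto
  also have "\<dots> = c * exp ((d1 + d2) * T) * kernel T gx fx A D"
    by (simp add: kernel_def algebra_simps)
  finally show ?thesis .
qed

section \<open>Discrete variation of constants\<close>

definition profile :: "real \<Rightarrow> real \<Rightarrow> real \<Rightarrow> real \<Rightarrow> real \<Rightarrow> nat \<Rightarrow> real" where
  "profile h gx fx A D k = gx * exp ((A + D) * h) ^ k + fx * h * (\<Sum>j<k. exp ((A + D) * h) ^ j)"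

text \<open>\<open>profile\<close> solves the affine recursion of the squared Lipschitz constant,
  with \<open>k\<close> counting steps back from the terminal time. \<open>conv\<close> is the
  Duhamel sum of a source \<open>p\<close>: it starts at 0 and transports each new contribution by
  the factor \<open>r\<close> per step.\<close>

definition conv :: "real \<Rightarrow> (nat \<Rightarrow> real) \<Rightarrow> nat \<Rightarrow> real" where
  "conv r p k = (\<Sum>j<k. r ^ (k - j) * p j)"

lemma conv_0 [simp]: "conv r p 0 = 0"
  by (simp add: conv_def)

lemma conv_Suc: "conv r p (Suc k) = r * (conv r p k + p k)"
  by (simp add: conv_def sum_distrib_left distrib_left Suc_diff_le mult.assoc)

lemma profile_0 [simp]: "profile h gx fx A D 0 = gx"
  by (simp add: profile_def)

lemma profile_Suc: "profile h gx fx A D (Suc k) = exp ((A + D) * h) * profile h gx fx A D k + fx * h"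
  unfolding profile_def sum.lessThan_Suc_shift
  by (simp add: sum_distrib_left algebra_simps)

lemma profile_nonneg: "0 \<le> profile h gx fx A D k" if "0 \<le> h" "0 \<le> gx" "0 \<le> fx"
  using that by (simp add: profile_def sum_nonneg)

lemma conv_nonneg: "0 \<le> conv r p k" if "0 \<le> r" "\<And>j. 0 \<le> p j"
  using that by (simp add: conv_def sum_nonneg)

text \<open>For \<open>A + D < 0\<close> the largest power is the one with exponent 0; this is the
  origin of the maximum with 1 in \<open>L1\<close>.\<close>

lemma profile_le:
  assumes "0 \<le> h" "0 \<le> gx" "0 \<le> fx"
  shows "profile h gx fx A D k \<le> (gx + fx * (h * real k)) * max (exp ((A + D) * (h * real k))) 1"
proof -
  let ?m = "max (exp ((A + D) * (h * real k))) 1"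
  have *: "exp ((A + D) * h) ^ j \<le> ?m" if "j \<le> k" for j
  proof (cases "0 \<le> A + D")
    case True
    then have "(A + D) * h * real j \<le> (A + D) * h * real k"
      using assms that by (intro mult_left_mono) auto
    then show ?thesis by (simp add: mult_ac le_max_iff_disj flip: exp_of_nat_mult)
  next
    case False
    then have "exp ((A + D) * h) ^ j \<le> 1"
      using assms by (intro power_le_one) (auto simp: mult_le_0_iff)
    then show ?thesis by simp
  qed
  have "(\<Sum>j<k. exp ((A + D) * h) ^ j) \<le> (\<Sum>j<k. ?m)"
    by (intro sum_mono *) simp
  then have "profile h gx fx A D k \<le> gx * ?m + fx * h * (real k * ?m)"
    unfolding profile_def using assms * by (intro add_mono mult_left_mono) auto
  then show ?thesis by (simp add: algebra_simps)
qed

text \<open>The exponents separate: after the substitution \<open>w = k + l - j\<close> the rate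
  \<open>D\<close> acts only on \<open>l\<close> and the rate \<open>A\<close> only on
  \<open>w\<close>. The terminal part becomes a \<open>\<Gamma>1\<close> integrand, and the source
  part a triangular double sum of a product.\<close>

lemma conv_profile_eq:
  "conv (exp (A * h)) (profile h gx fx A D) k
    = gx * exp (A * h * real k) * (\<Sum>j<k. exp (D * h * real j))
      + fx * h * (\<Sum>l<k. exp (D * h * real l) * (\<Sum>w\<in>{l<..<k}. exp (A * h * real w)))"
proof -
  have *: "exp (A * h) ^ (k - j) * exp ((A + D) * h) ^ l = exp (D * h * real l) * exp (A * h * real (k + l - j))"
    if "j \<le> k" for j l
    using that by (simp add: exp_of_nat_mult[symmetric] exp_add[symmetric] of_nat_diff algebra_simps)
  have "conv (exp (A * h)) (profile h gx fx A D) k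
      = (\<Sum>j<k. gx * (exp (A * h) ^ (k - j) * exp ((A + D) * h) ^ j)
          + fx * h * (\<Sum>l<j. exp (A * h) ^ (k - j) * exp ((A + D) * h) ^ l))"
    unfolding conv_def profile_def by (simp add: sum_distrib_left algebra_simps)
  also have "\<dots> = (\<Sum>j<k. gx * (exp (D * h * real j) * exp (A * h * real k))
          + fx * h * (\<Sum>l<j. exp (D * h * real l) * exp (A * h * real (k + l - j))))"
  proof (rule sum.cong[OF refl])
    fix j assume "j \<in> {..<k}"
    then have "j \<le> k" by simp
    have inner: "(\<Sum>l<j. exp (A * h) ^ (k - j) * exp ((A + D) * h) ^ l)
        = (\<Sum>l<j. exp (D * h * real l) * exp (A * h * real (k + l - j)))"
      by (rule sum.cong[OF refl], rule *[OF \<open>j \<le> k\<close>])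
    show "gx * (exp (A * h) ^ (k - j) * exp ((A + D) * h) ^ j)
          + fx * h * (\<Sum>l<j. exp (A * h) ^ (k - j) * exp ((A + D) * h) ^ l)
        = gx * (exp (D * h * real j) * exp (A * h * real k))
          + fx * h * (\<Sum>l<j. exp (D * h * real l) * exp (A * h * real (k + l - j)))"
      unfolding inner *[OF \<open>j \<le> k\<close>] by simp
  qed
  also have "\<dots> = gx * exp (A * h * real k) * (\<Sum>j<k. exp (D * h * real j))
      + fx * h * (\<Sum>j<k. \<Sum>l<j. exp (D * h * real l) * exp (A * h * real (k + l - j)))"
    by (simp add: sum.distrib sum_distrib_left mult_ac)
  also have "(\<Sum>j<k. \<Sum>l<j. exp (D * h * real l) * exp (A * h * real (k + l - j)))
      = (\<Sum>l<k. \<Sum>j\<in>{l<..<k}. exp (D * h * real l) * exp (A * h * real (k + l - j)))"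
    by (subst (1 2) sum.Sigma) (auto intro!: sum.reindex_bij_witness[of _ prod.swap prod.swap])
  also have "\<dots> = (\<Sum>l<k. exp (D * h * real l) * (\<Sum>w\<in>{l<..<k}. exp (A * h * real w)))"
    unfolding sum_distrib_left
  proof (rule sum.cong[OF refl])
    fix l
    show "(\<Sum>j\<in>{l<..<k}. exp (D * h * real l) * exp (A * h * real (k + l - j)))
        = (\<Sum>w\<in>{l<..<k}. exp (D * h * real l) * exp (A * h * real w))"
      \<comment> \<open>The reflection \<open>j \<mapsto> k + l - j\<close> is an involution of the
        open interval between \<open>l\<close> and \<open>k\<close>.\<close>
      by (rule sum.reindex_bij_witness[of _ "\<lambda>j. k + l - j" "\<lambda>j. k + l - j"]) auto
  qed
  finally show ?thesis .
qed

text \<open>With \<open>\<theta> = k / n\<close> the terminal part is the integrand of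
  \<open>\<Gamma>1\<close> at \<open>\<theta>\<close> up to \<open>1 / \<Gamma>0 (D * h)\<close>;
  uniformity in \<open>k\<close> turns it into the supremum. In the source part the triangle is
  enlarged to the full square, where the double sum factors into two \<open>\<Gamma>0\<close>
  terms.\<close>

lemma conv_profile_le:
  assumes "0 < T" "0 < n" "k \<le> n" "0 \<le> gx" "0 \<le> fx" and h: "h = T / real n"
  shows "h * conv (exp (A * h)) (profile h gx fx A D) k \<le> exp ((\<bar>A\<bar> + \<bar>D\<bar>) * h) * kernel T gx fx A D"
proof -
  have hpos: "0 < h" and hn: "h * real n = T" using assms(1,2) by (auto simp: h)
  define \<theta> where "\<theta> = real k / real n"
  have \<theta>: "0 \<le> \<theta>" "\<theta> \<le> 1" and hk: "h * real k = T * \<theta>" using assms by (auto simp: \<theta>_def)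
  have inv: "1 / \<Gamma>0 (z * h) \<le> exp (\<bar>z\<bar> * h)" for z
    using inverse_\<Gamma>0_le[of "z * h"] hpos by (simp add: abs_mult)
  have "h * (exp (A * h * real k) * (\<Sum>j<k. exp (D * h * real j)))
      = T * (\<theta> * exp (\<theta> * (A * T)) * \<Gamma>0 (\<theta> * (D * T))) * (1 / \<Gamma>0 (D * h))"
  proof -
    have e: "A * h * real k = \<theta> * (A * T)" "real k * (D * h) = \<theta> * (D * T)"
      using hk by (simp_all add: mult_ac)
    show ?thesis unfolding sum_exp_eq e
      using arg_cong[OF hk, of "\<lambda>u. u * exp (\<theta> * (A * T)) * \<Gamma>0 (\<theta> * (D * T)) / \<Gamma>0 (D * h)"]
      by (simp add: mult_ac)
  qed
  also have "\<dots> \<le> T * \<Gamma>1 (A * T) (D * T) * exp (\<bar>D\<bar> * h)"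
    using \<theta> assms \<Gamma>1_nonneg \<Gamma>0_pos[THEN less_imp_le]
    by (intro mult_mono mult_left_mono le_\<Gamma>1 inv) auto
  also have "\<dots> \<le> T * \<Gamma>1 (A * T) (D * T) * exp ((\<bar>A\<bar> + \<bar>D\<bar>) * h)"
    using assms(1) hpos \<Gamma>1_nonneg by (intro mult_left_mono) auto
  finally have g: "h * (exp (A * h * real k) * (\<Sum>j<k. exp (D * h * real j)))
      \<le> T * \<Gamma>1 (A * T) (D * T) * exp ((\<bar>A\<bar> + \<bar>D\<bar>) * h)" .
  have S: "h * (\<Sum>j<n. exp (z * h * real j)) = T * \<Gamma>0 (z * T) * (1 / \<Gamma>0 (z * h))" for z
  proof -
    have "real n * (z * h) = z * T" using hn by (simp add: mult_ac)
    then show ?thesis unfolding sum_exp_eq by (simp add: hn[symmetric] mult_ac)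
  qed
  have "(\<Sum>l<k. exp (D * h * real l) * (\<Sum>w\<in>{l<..<k}. exp (A * h * real w)))
      \<le> (\<Sum>l<k. exp (D * h * real l) * (\<Sum>w<n. exp (A * h * real w)))"
    using assms by (intro sum_mono mult_left_mono sum_mono2) auto
  also have "\<dots> \<le> (\<Sum>l<n. exp (D * h * real l) * (\<Sum>w<n. exp (A * h * real w)))"
    using assms by (intro sum_mono2) (auto intro!: mult_nonneg_nonneg sum_nonneg)
  finally have "h * h * (\<Sum>l<k. exp (D * h * real l) * (\<Sum>w\<in>{l<..<k}. exp (A * h * real w)))
      \<le> h * h * (\<Sum>l<n. exp (D * h * real l) * (\<Sum>w<n. exp (A * h * real w)))"
    using hpos by (intro mult_left_mono) auto
  also have "\<dots> = (h * (\<Sum>l<n. exp (D * h * real l))) * (h * (\<Sum>w<n. exp (A * h * real w)))"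
    unfolding sum_distrib_right[symmetric] by (simp only: mult_ac)
  also have "\<dots> = T * \<Gamma>0 (D * T) * (T * \<Gamma>0 (A * T)) * ((1 / \<Gamma>0 (D * h)) * (1 / \<Gamma>0 (A * h)))"
    unfolding S by (simp add: mult_ac)
  also have "\<dots> \<le> T * \<Gamma>0 (D * T) * (T * \<Gamma>0 (A * T)) * (exp (\<bar>D\<bar> * h) * exp (\<bar>A\<bar> * h))"
    using assms \<Gamma>0_pos[THEN less_imp_le] by (intro mult_left_mono mult_mono inv) auto
  finally have f: "h * h * (\<Sum>l<k. exp (D * h * real l) * (\<Sum>w\<in>{l<..<k}. exp (A * h * real w)))
      \<le> T * \<Gamma>0 (D * T) * (T * \<Gamma>0 (A * T)) * exp ((\<bar>A\<bar> + \<bar>D\<bar>) * h)"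
    by (simp add: algebra_simps exp_add)
  have "h * conv (exp (A * h)) (profile h gx fx A D) k
      = gx * (h * (exp (A * h * real k) * (\<Sum>j<k. exp (D * h * real j))))
        + fx * (h * h * (\<Sum>l<k. exp (D * h * real l) * (\<Sum>w\<in>{l<..<k}. exp (A * h * real w))))"
    unfolding conv_profile_eq by (simp add: distrib_left mult_ac)
  also have "\<dots> \<le> gx * (T * \<Gamma>1 (A * T) (D * T) * exp ((\<bar>A\<bar> + \<bar>D\<bar>) * h))
        + fx * (T * \<Gamma>0 (D * T) * (T * \<Gamma>0 (A * T)) * exp ((\<bar>A\<bar> + \<bar>D\<bar>) * h))"
    using assms by (intro add_mono mult_left_mono g f) auto
  also have "\<dots> = exp ((\<bar>A\<bar> + \<bar>D\<bar>) * h) * kernel T gx fx A D"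
    by (simp add: kernel_def algebra_simps)
  finally show ?thesis .
qed

lemma sum_exp_le:
  assumes "0 < T" "0 < n" "k \<le> n" and h: "h = T / real n"
  shows "h * (\<Sum>j<k. exp (A * h) ^ j) \<le> T * \<Gamma>0 (A * T) * exp (\<bar>A\<bar> * h)"
proof -
  have hpos: "0 < h" and hn: "h * real n = T" using assms(1,2) by (auto simp: h)
  have "h * (\<Sum>j<k. exp (A * h) ^ j) \<le> h * (\<Sum>j<n. exp (A * h) ^ j)"
    using assms hpos by (intro mult_left_mono sum_mono2) auto
  also have "(\<Sum>j<n. exp (A * h) ^ j) = (\<Sum>j<n. exp (A * h * real j))"
    by (simp add: exp_of_nat2_mult)
  also have "h * \<dots> = T * \<Gamma>0 (A * T) * (1 / \<Gamma>0 (A * h))"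
  proof -
    have "real n * (A * h) = A * T" using hn by (simp add: mult_ac)
    then show ?thesis unfolding sum_exp_eq by (simp add: hn[symmetric] mult_ac)
  qed
  also have "\<dots> \<le> T * \<Gamma>0 (A * T) * exp (\<bar>A\<bar> * h)"
    using assms hpos \<Gamma>0_pos[THEN less_imp_le] inverse_\<Gamma>0_le[of "A * h"]
    by (intro mult_left_mono) (auto simp: abs_mult)
  finally show ?thesis .
qed

section \<open>Backward propagation of the bounds\<close>

lemma power2_sum_young:
  fixes u v :: real
  assumes "0 < lam"
  shows "(u + v)\<^sup>2 \<le> (1 + lam) * u\<^sup>2 + (1 + inverse lam) * v\<^sup>2"
proof -
  have "0 \<le> (sqrt lam * u - inverse (sqrt lam) * v)\<^sup>2" by simp
  also have "\<dots> = lam * u\<^sup>2 + inverse lam * v\<^sup>2 - 2 * (u * v)"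
    using assms by (simp add: power2_diff power_mult_distrib power_inverse)
  finally show ?thesis by (simp add: power2_sum algebra_simps)
qed

locale euler_scheme =
  fixes M :: "'a measure" and W :: "real \<Rightarrow> 'a \<Rightarrow> real" and T :: real and C :: bounds
    and b \<sigma> :: "real \<Rightarrow> real \<Rightarrow> real \<Rightarrow> real"
    and f :: "real \<Rightarrow> real \<Rightarrow> real \<Rightarrow> real \<Rightarrow> real" and g :: "real \<Rightarrow> real"
    and n :: nat and e :: real
  assumes T_pos: "0 < T"
    and brownian: "brownian_motion M W T"
    and coefficients: "standing_assumption T C b \<sigma> f g"
    and n_pos: "0 < n"
    and small_mesh: "small_step C e (T / real n)"
begin

definition h :: real where "h = T / real n"

abbreviation F :: "(nat \<Rightarrow> real \<Rightarrow> real) \<Rightarrow> nat \<Rightarrow> real \<Rightarrow> real" where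
  "F \<equiv> F_op M W T b \<sigma> f g n"

abbreviation S :: "nat \<Rightarrow> (real \<Rightarrow> real) \<Rightarrow> (real \<Rightarrow> real) \<Rightarrow> real \<Rightarrow> real" where
  "S \<equiv> step M W T b \<sigma> f n"

lemma euler_step_at:
  assumes "i < n"
  shows "euler_step M (\<lambda>\<omega>. W (real (Suc i) * h) \<omega> - W (real i * h) \<omega>) h C
    (b (real i * h)) (\<sigma> (real i * h)) (f (real i * h)) e"
proof -
  interpret brownian_motion M W T by (rule brownian)
  let ?t = "real i * h" and ?t' = "real (Suc i) * h"
  have h: "0 < h" using T_pos n_pos by (simp add: h_def)
  have "?t' \<le> real n * h" using assms h by (intro mult_right_mono) auto
  also have "\<dots> = T" using n_pos by (simp add: h_def)
  finally have t: "0 \<le> ?t" "?t < ?t'" "?t' \<le> T" "?t' - ?t = h" "?t \<in> {0..T}" "?t' \<in> {0..T}"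
    using h by (auto simp: algebra_simps)
  let ?N = "\<lambda>\<omega>. W ?t' \<omega> - W ?t \<omega>"
  have [measurable]: "W ?t' \<in> borel_measurable M" "W ?t \<in> borel_measurable M"
    using t W_measurable by auto
  have d: "distributed M lborel ?N (normal_density 0 (sqrt h))"
    using W_increment[of ?t ?t'] t by simp
  have mean: "expectation ?N = 0"
    by (rule normal_distributed_expectation[OF _ d]) (use h in simp)
  have "expectation (\<lambda>\<omega>. (?N \<omega> - expectation ?N)\<^sup>2) = (sqrt h)\<^sup>2"
    by (rule normal_distributed_variance[OF _ d]) (use h in simp)
  then have var: "expectation (\<lambda>\<omega>. (?N \<omega>)\<^sup>2) = h"
    unfolding mean diff_0_right real_sqrt_pow2[OF less_imp_le[OF h]] .
  \<comment> \<open>The integral of a non-integrable function is 0 by convention, so the nonzero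
    variance already forces integrability.\<close>
  have int: "integrable M (\<lambda>\<omega>. (?N \<omega>)\<^sup>2)"
  proof (rule ccontr)
    assume "\<not> integrable M (\<lambda>\<omega>. (?N \<omega>)\<^sup>2)"
    then have "expectation (\<lambda>\<omega>. (?N \<omega>)\<^sup>2) = 0"
      by (rule not_integrable_integral_eq)
    with var h show False by linarith
  qed
  have "centered_step M ?N h"
    by (rule centered_step.intro[OF prob_space_axioms centered_step_axioms.intro[OF _ int mean var h]]) measurable
  moreover have "coefficient_slice C (b ?t) (\<sigma> ?t) (f ?t)"
  proof -
    have "?t \<in> {0..T}" by (rule t)
    then show ?thesis
      using coefficients unfolding standing_assumption_def power2_abs by unfold_locales auto
  qed
  ultimately show ?thesis
    using small_mesh by (simp add: euler_step_def euler_step_axioms_def h_def)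
qed

lemma step_eq_V:
  assumes "i < n"
  shows "S i p q x = euler_step.V M (\<lambda>\<omega>. W (real (Suc i) * h) \<omega> - W (real i * h) \<omega>) h
    (b (real i * h)) (\<sigma> (real i * h)) (f (real i * h)) (p x) q x"
proof -
  interpret euler_step M "\<lambda>\<omega>. W (real (Suc i) * h) \<omega> - W (real i * h) \<omega>" h C
    "b (real i * h)" "\<sigma> (real i * h)" "f (real i * h)" e
    by (rule euler_step_at[OF assms])
  show ?thesis by (simp add: step_def V_def X_def \<psi>_def Let_def del: of_nat_Suc flip: h_def)
qed

lemma constants_nonneg:
  "0 \<le> g_x C" "0 \<le> f_x C" "0 \<le> g_0 C" "0 \<le> f_0 C" "0 \<le> B_y C" "0 \<le> B_0 C" "0 \<le> K_ub C" "0 \<le> f_z C"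
  using coefficients by (auto simp: standing_assumption_def B_y_def B_0_def)

lemma g_lipschitz: "(g x1 - g x2)\<^sup>2 \<le> g_x C * (x1 - x2)\<^sup>2"
  and g_growth: "(g x)\<^sup>2 \<le> g_0 C + g_x C * x\<^sup>2"
  using coefficients unfolding standing_assumption_def power2_abs by blast+

lemma h_pos: "0 < h" and e_pos: "0 < e" and h_le: "h \<le> e" and factor_nonneg: "0 \<le> 1 + (A_f C + e) * h"
  using small_mesh by (auto simp: small_step_def h_def)

lemma hn: "h * real n = T"
  using n_pos by (simp add: h_def)

text \<open>The forward rate when the inserted function has squared Lipschitz (or growth) constant
  \<open>a\<close>: the feedback through \<open>y\<close> adds \<open>B_y a\<close>, and
  \<open>e\<close> is the perturbation.\<close>

definition D :: "real \<Rightarrow> real" where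
  "D a = A_b C + e + (1 + e) * B_y C * a"

abbreviation R_f :: real where
  "R_f \<equiv> exp ((A_f C + e) * h)"

lemma factor_product_le: "(1 + (A_f C + e) * h) * (1 + D u * h) \<le> exp ((A_f C + e + D u) * h)"
proof -
  let ?c = "1 + (A_f C + e) * h"
  \<comment> \<open>\<open>1 + D u * h\<close> may be negative, so it is replaced first, using the
    sign of \<open>?c\<close>; the exponential is then a nonnegative multiplier for the second
    replacement.\<close>
  have "?c * (1 + D u * h) \<le> ?c * exp (D u * h)"
    by (intro mult_left_mono exp_ge_add_one_self factor_nonneg)
  also have "\<dots> \<le> R_f * exp (D u * h)"
    by (intro mult_right_mono exp_ge_add_one_self) simp
  finally show ?thesis by (simp add: distrib_right exp_add)
qed

text \<open>The bounds \<open>y\<close> and \<open>y2\<close> are required only at the given points,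
  so \<open>d\<close> and \<open>H\<close> may depend on \<open>x1\<close> and \<open>x2\<close>.
  The difference of the inserted values drives \<open>P\<close> at rate \<open>D a\<close>, the size
  of the second one drives \<open>Q\<close> at rate \<open>D G\<close>, and what is left over goes
  into the constant part.\<close>

lemma step_diff_sq_le:
  assumes "i < n" "quadratic_growth q1" "quadratic_growth q2" "0 \<le> P" "0 \<le> Q" "0 \<le> R" "0 \<le> d" "0 \<le> H"
    and "\<And>z1 z2. (q1 z1 - q2 z2)\<^sup>2 \<le> P * (z1 - z2)\<^sup>2 + Q * z2\<^sup>2 + R"
    and y: "(p1 x1 - p2 x2)\<^sup>2 \<le> a * (x1 - x2)\<^sup>2 + d"
    and y2: "(p2 x2)\<^sup>2 \<le> G * x2\<^sup>2 + H"
  shows "(S i p1 q1 x1 - S i p2 q2 x2)\<^sup>2 \<le>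
      (exp ((A_f C + e + D a) * h) * P + (1 + e) * f_x C * h) * (x1 - x2)\<^sup>2
      + exp ((A_f C + e + D G) * h) * Q * x2\<^sup>2
      + R_f * ((1 + e) * B_y C * h * d * P + (1 + e) * (B_y C * H + B_0 C) * h * Q + R)"
proof -
  interpret euler_step M "\<lambda>\<omega>. W (real (Suc i) * h) \<omega> - W (real i * h) \<omega>" h C
    "b (real i * h)" "\<sigma> (real i * h)" "f (real i * h)" e
    by (rule euler_step_at[OF assms(1)])
  let ?c = "1 + (A_f C + e) * h"
  have B: "0 \<le> (1 + e) * B_y C * h"
    using constants_nonneg e_pos h_pos by simp
  have 1: "(1 + (A_b C + e) * h) * (x1 - x2)\<^sup>2 + (1 + e) * B_y C * h * (p1 x1 - p2 x2)\<^sup>2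
      \<le> (1 + D a * h) * (x1 - x2)\<^sup>2 + (1 + e) * B_y C * h * d"
    using mult_left_mono[OF y B] by (simp add: D_def algebra_simps)
  have 2: "(1 + (A_b C + e) * h) * x2\<^sup>2 + (1 + e) * B_y C * h * (p2 x2)\<^sup>2 + (1 + e) * B_0 C * h
      \<le> (1 + D G * h) * x2\<^sup>2 + (1 + e) * (B_y C * H + B_0 C) * h"
    using mult_left_mono[OF y2 B] by (simp add: D_def algebra_simps)
  have rest: "0 \<le> (1 + e) * B_y C * h * d * P + (1 + e) * (B_y C * H + B_0 C) * h * Q + R"
    using constants_nonneg e_pos h_pos assms(4-8) by simp
  have "(S i p1 q1 x1 - S i p2 q2 x2)\<^sup>2 \<le> ?c *
      (P * ((1 + (A_b C + e) * h) * (x1 - x2)\<^sup>2 + (1 + e) * B_y C * h * (p1 x1 - p2 x2)\<^sup>2)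
        + Q * ((1 + (A_b C + e) * h) * x2\<^sup>2 + (1 + e) * B_y C * h * (p2 x2)\<^sup>2 + (1 + e) * B_0 C * h) + R)
      + (1 + e) * h * (f_x C * (x1 - x2)\<^sup>2)"
    unfolding step_eq_V[OF assms(1)] by (rule V_diff_sq_le) (use assms in auto)
  also have "\<dots> \<le> ?c * (P * ((1 + D a * h) * (x1 - x2)\<^sup>2 + (1 + e) * B_y C * h * d)
        + Q * ((1 + D G * h) * x2\<^sup>2 + (1 + e) * (B_y C * H + B_0 C) * h) + R)
      + (1 + e) * h * (f_x C * (x1 - x2)\<^sup>2)"
    using assms(4,5) by (intro add_right_mono mult_left_mono add_mono 1 2 factor_nonneg order_refl)
  also have "\<dots> = ?c * (1 + D a * h) * (P * (x1 - x2)\<^sup>2) + ?c * (1 + D G * h) * (Q * x2\<^sup>2)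
      + ?c * ((1 + e) * B_y C * h * d * P + (1 + e) * (B_y C * H + B_0 C) * h * Q + R)
      + (1 + e) * f_x C * h * (x1 - x2)\<^sup>2"
    by (simp add: algebra_simps)
  also have "\<dots> \<le> exp ((A_f C + e + D a) * h) * (P * (x1 - x2)\<^sup>2)
      + exp ((A_f C + e + D G) * h) * (Q * x2\<^sup>2)
      + R_f * ((1 + e) * B_y C * h * d * P + (1 + e) * (B_y C * H + B_0 C) * h * Q + R)
      + (1 + e) * f_x C * h * (x1 - x2)\<^sup>2"
    by (intro add_right_mono add_mono mult_right_mono factor_product_le exp_ge_add_one_self rest mult_nonneg_nonneg assms(4,5) zero_le_power2)
  finally show ?thesis by (simp add: algebra_simps)
qed

lemma step_sq_le:
  assumes "i < n" "quadratic_growth q" "0 \<le> G" "0 \<le> H" "0 \<le> H'"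
    and "\<And>z. (q z)\<^sup>2 \<le> G * z\<^sup>2 + H"
    and y: "(p x)\<^sup>2 \<le> a * x\<^sup>2 + H'"
  shows "(S i p q x)\<^sup>2 \<le> (exp ((A_f C + e + D a) * h) * G + (1 + e) * f_x C * h) * x\<^sup>2
      + (R_f * (H + (1 + e) * (B_y C * H' + B_0 C) * h * G) + (1 + e) * f_0 C * h)"
proof -
  interpret euler_step M "\<lambda>\<omega>. W (real (Suc i) * h) \<omega> - W (real i * h) \<omega>" h C
    "b (real i * h)" "\<sigma> (real i * h)" "f (real i * h)" e
    by (rule euler_step_at[OF assms(1)])
  let ?c = "1 + (A_f C + e) * h"
  have B: "0 \<le> (1 + e) * B_y C * h"
    using constants_nonneg e_pos h_pos by simp
  have 1: "(1 + (A_b C + e) * h) * x\<^sup>2 + (1 + e) * B_y C * h * (p x)\<^sup>2 + (1 + e) * B_0 C * h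
      \<le> (1 + D a * h) * x\<^sup>2 + (1 + e) * (B_y C * H' + B_0 C) * h"
    using mult_left_mono[OF y B] by (simp add: D_def algebra_simps)
  have rest: "0 \<le> H + (1 + e) * (B_y C * H' + B_0 C) * h * G"
    using constants_nonneg e_pos h_pos assms(3-5) by simp
  have "(S i p q x)\<^sup>2 \<le> ?c *
      (G * ((1 + (A_b C + e) * h) * x\<^sup>2 + (1 + e) * B_y C * h * (p x)\<^sup>2 + (1 + e) * B_0 C * h) + H)
      + (1 + e) * h * (f_0 C + f_x C * x\<^sup>2)"
    unfolding step_eq_V[OF assms(1)] by (rule V_sq_le) (use assms in auto)
  also have "\<dots> \<le> ?c * (G * ((1 + D a * h) * x\<^sup>2 + (1 + e) * (B_y C * H' + B_0 C) * h) + H)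
      + (1 + e) * h * (f_0 C + f_x C * x\<^sup>2)"
    using assms(3) by (intro add_right_mono mult_left_mono 1 factor_nonneg)
  also have "\<dots> = ?c * (1 + D a * h) * (G * x\<^sup>2) + ?c * (H + (1 + e) * (B_y C * H' + B_0 C) * h * G)
      + (1 + e) * h * (f_0 C + f_x C * x\<^sup>2)"
    by (simp add: algebra_simps)
  also have "\<dots> \<le> exp ((A_f C + e + D a) * h) * (G * x\<^sup>2)
      + R_f * (H + (1 + e) * (B_y C * H' + B_0 C) * h * G) + (1 + e) * h * (f_0 C + f_x C * x\<^sup>2)"
    by (intro add_right_mono add_mono mult_right_mono factor_product_le exp_ge_add_one_self rest
        mult_nonneg_nonneg assms(3) zero_le_power2)
  finally show ?thesis by (simp add: algebra_simps)
qed

section \<open>Bounds along the whole backward recursion\<close>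

abbreviation P :: "real \<Rightarrow> nat \<Rightarrow> real" where
  "P a \<equiv> profile h (g_x C) ((1 + e) * f_x C) (A_f C + e) (D a)"

lemma P_nonneg: "0 \<le> P a k"
  using constants_nonneg e_pos h_pos by (intro profile_nonneg) auto

lemma F_terminal: "F \<phi> n = g"
  by (simp add: F_op.simps)

lemma F_backward: "F \<phi> (n - Suc k) = S (n - Suc k) (\<phi> (n - Suc k)) (F \<phi> (n - k))" if "Suc k \<le> n"
  using that by (subst F_op.simps) (auto simp: Suc_diff_Suc)

lemma F_lipschitz:
  assumes "\<And>i x1 x2. i < n \<Longrightarrow> (\<phi> i x1 - \<phi> i x2)\<^sup>2 \<le> a * (x1 - x2)\<^sup>2" "k \<le> n"
  shows "(F \<phi> (n - k) x1 - F \<phi> (n - k) x2)\<^sup>2 \<le> P a k * (x1 - x2)\<^sup>2"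
  using assms(2)
proof (induction k arbitrary: x1 x2)
  case 0
  then show ?case by (simp add: F_terminal g_lipschitz)
next
  case (Suc k)
  let ?q = "F \<phi> (n - k)" and ?i = "n - Suc k"
  have IH: "(?q z1 - ?q z2)\<^sup>2 \<le> P a k * (z1 - z2)\<^sup>2" for z1 z2
    using Suc by simp
  have q: "quadratic_growth ?q"
    by (rule quadratic_growth_of_lipschitz[OF P_nonneg IH])
  \<comment> \<open>One function in both roles gives \<open>Q = R = d = 0\<close>; the growth
    hypothesis is met by \<open>G = 0\<close> and the actual value
    \<open>H = (\<phi> ?i x2)\<^sup>2\<close>.\<close>
  have "(S ?i (\<phi> ?i) ?q x1 - S ?i (\<phi> ?i) ?q x2)\<^sup>2 \<le>
      (exp ((A_f C + e + D a) * h) * P a k + (1 + e) * f_x C * h) * (x1 - x2)\<^sup>2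
      + exp ((A_f C + e + D 0) * h) * 0 * x2\<^sup>2
      + R_f * ((1 + e) * B_y C * h * 0 * P a k + (1 + e) * (B_y C * (\<phi> ?i x2)\<^sup>2 + B_0 C) * h * 0 + 0)"
    by (rule step_diff_sq_le) (use Suc.prems IH q P_nonneg assms in auto)
  then show ?case
    unfolding F_backward[OF Suc.prems] by (simp add: profile_Suc)
qed

lemma F_quadratic_growth:
  assumes "\<And>i x1 x2. i < n \<Longrightarrow> (\<phi> i x1 - \<phi> i x2)\<^sup>2 \<le> a * (x1 - x2)\<^sup>2" "k \<le> n"
  shows "quadratic_growth (F \<phi> (n - k))"
  by (rule quadratic_growth_of_lipschitz[OF P_nonneg F_lipschitz[OF assms]])

text \<open>The discrete form of \<open>L2_fun + c1_fun * H\<close>: transported terminal data,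
  accumulated driver \<open>f_0\<close>, and the constant growth of the forward step weighted by the
  quadratic coefficient \<open>P a\<close>.\<close>

definition growth_profile :: "real \<Rightarrow> real \<Rightarrow> nat \<Rightarrow> real" where
  "growth_profile a H k = R_f ^ k * g_0 C + (1 + e) * f_0 C * h * (\<Sum>j<k. R_f ^ j)
    + (1 + e) * (B_y C * H + B_0 C) * h * conv R_f (P a) k"

lemma growth_profile_nonneg: "0 \<le> growth_profile a H k" if "0 \<le> H"
  unfolding growth_profile_def using constants_nonneg e_pos h_pos that
  by (intro add_nonneg_nonneg mult_nonneg_nonneg sum_nonneg conv_nonneg P_nonneg) auto

lemma growth_profile_Suc:
  "growth_profile a H (Suc k)
    = R_f * (growth_profile a H k + (1 + e) * (B_y C * H + B_0 C) * h * P a k) + (1 + e) * f_0 C * h"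
  unfolding growth_profile_def conv_Suc sum.lessThan_Suc_shift
  by (simp add: sum_distrib_left algebra_simps)

text \<open>The quadratic coefficient obeys the same recursion as the squared Lipschitz constant:
  same terminal value \<open>g_x\<close>, same source \<open>f_x\<close>, same feedback
  \<open>a\<close>. Hence a single constant serves for both \<open>L\<close> and
  \<open>G\<close>.\<close>

lemma F_growth:
  assumes lip: "\<And>i x1 x2. i < n \<Longrightarrow> (\<phi> i x1 - \<phi> i x2)\<^sup>2 \<le> a * (x1 - x2)\<^sup>2"
    and growth: "\<And>i x. i < n \<Longrightarrow> (\<phi> i x)\<^sup>2 \<le> a * x\<^sup>2 + H" and "0 \<le> H" "k \<le> n"
  shows "(F \<phi> (n - k) x)\<^sup>2 \<le> P a k * x\<^sup>2 + growth_profile a H k"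
  using assms(4)
proof (induction k arbitrary: x)
  case 0
  then show ?case using g_growth[of x] by (simp add: F_terminal growth_profile_def)
next
  case (Suc k)
  let ?q = "F \<phi> (n - k)" and ?i = "n - Suc k"
  have q: "quadratic_growth ?q"
    by (rule F_quadratic_growth[OF lip]) (use Suc.prems in auto)
  have "(S ?i (\<phi> ?i) ?q x)\<^sup>2 \<le> (exp ((A_f C + e + D a) * h) * P a k + (1 + e) * f_x C * h) * x\<^sup>2
      + (R_f * (growth_profile a H k + (1 + e) * (B_y C * H + B_0 C) * h * P a k) + (1 + e) * f_0 C * h)"
    by (rule step_sq_le) (use Suc q P_nonneg growth growth_profile_nonneg assms(3) in auto)
  then show ?case
    unfolding F_backward[OF Suc.prems] growth_profile_Suc by (simp add: profile_Suc)
qed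

text \<open>Young's inequality splits \<open>\<phi> i x1 - \<phi>' i x2\<close> at
  \<open>\<phi> i x2\<close>. The Lipschitz part, with weight \<open>1 + lam\<close>, enters the
  rate of \<open>P\<close>; the diagonal distance, with weight \<open>1 + inverse lam\<close>, is a
  source of size \<open>w P\<close> that is accumulated by \<open>conv\<close>. Its quadratic
  coefficient also grows with the forward step, which \<open>\<mu>\<close> bounds, and leaks
  \<open>\<kappa> h\<close> times itself into the constant part at each step.\<close>

lemma F_contraction:
  assumes lip: "\<And>i x1 x2. i < n \<Longrightarrow> (\<phi> i x1 - \<phi> i x2)\<^sup>2 \<le> a * (x1 - x2)\<^sup>2"
    and lip': "\<And>i x1 x2. i < n \<Longrightarrow> (\<phi>' i x1 - \<phi>' i x2)\<^sup>2 \<le> a * (x1 - x2)\<^sup>2"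
    and growth': "\<And>i x. i < n \<Longrightarrow> (\<phi>' i x)\<^sup>2 \<le> a * x\<^sup>2 + H"
    and diff: "\<And>i x. i < n \<Longrightarrow> (\<phi> i x - \<phi>' i x)\<^sup>2 \<le> G\<^sub>d * x\<^sup>2 + H\<^sub>d"
    and nonneg: "0 \<le> H" "0 \<le> G\<^sub>d" "0 \<le> H\<^sub>d" "0 < lam" and "k \<le> n"
  defines "w \<equiv> (1 + inverse lam) * (1 + e) * B_y C * h"
    and "\<kappa> \<equiv> (1 + e) * (B_y C * H + B_0 C)"
    and "c \<equiv> conv R_f (P ((1 + lam) * a))"
    and "\<mu> \<equiv> \<lambda>k. max (exp (D a * (h * real k))) 1"
  shows "(F \<phi> (n - k) x1 - F \<phi>' (n - k) x2)\<^sup>2 \<le> P ((1 + lam) * a) k * (x1 - x2)\<^sup>2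
      + \<mu> k * w * G\<^sub>d * c k * x2\<^sup>2 + (w * H\<^sub>d + \<kappa> * (h * real k) * \<mu> n * w * G\<^sub>d) * c k"
  using \<open>k \<le> n\<close>
proof (induction k arbitrary: x1 x2)
  case 0
  then show ?case by (simp add: F_terminal g_lipschitz c_def)
next
  case (Suc k)
  let ?p = "P ((1 + lam) * a)" and ?q = "F \<phi> (n - k)" and ?q' = "F \<phi>' (n - k)" and ?i = "n - Suc k"
  let ?d = "(1 + inverse lam) * (G\<^sub>d * x2\<^sup>2 + H\<^sub>d)"
  let ?Q = "\<mu> k * w * G\<^sub>d * c k" and ?R = "(w * H\<^sub>d + \<kappa> * (h * real k) * \<mu> n * w * G\<^sub>d) * c k"
  have i: "?i < n" "k \<le> n" using Suc.prems by auto
  have w: "0 \<le> w" and \<kappa>: "0 \<le> \<kappa>" and c: "0 \<le> c k" and \<mu>: "1 \<le> \<mu> j" for j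
    using constants_nonneg e_pos h_pos nonneg
    by (auto simp: w_def \<kappa>_def c_def \<mu>_def intro!: mult_nonneg_nonneg conv_nonneg P_nonneg)
  have \<mu>0: "0 \<le> \<mu> j" for j using \<mu>[of j] by linarith
  have p: "0 \<le> ?p k" by (rule P_nonneg)
  have young: "(\<phi> ?i x1 - \<phi>' ?i x2)\<^sup>2 \<le> (1 + lam) * a * (x1 - x2)\<^sup>2 + ?d"
  proof -
    let ?u = "\<phi> ?i x1 - \<phi> ?i x2" and ?v = "\<phi> ?i x2 - \<phi>' ?i x2"
    have "(\<phi> ?i x1 - \<phi>' ?i x2)\<^sup>2 = (?u + ?v)\<^sup>2" by simp
    also have "\<dots> \<le> (1 + lam) * ?u\<^sup>2 + (1 + inverse lam) * ?v\<^sup>2"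
      by (rule power2_sum_young[OF nonneg(4)])
    also have "\<dots> \<le> (1 + lam) * (a * (x1 - x2)\<^sup>2) + (1 + inverse lam) * (G\<^sub>d * x2\<^sup>2 + H\<^sub>d)"
      using nonneg(4) by (intro add_mono mult_left_mono lip diff i) auto
    finally show ?thesis by (simp add: mult.assoc)
  qed
  have "(S ?i (\<phi> ?i) ?q x1 - S ?i (\<phi>' ?i) ?q' x2)\<^sup>2 \<le>
      (exp ((A_f C + e + D ((1 + lam) * a)) * h) * ?p k + (1 + e) * f_x C * h) * (x1 - x2)\<^sup>2
      + exp ((A_f C + e + D a) * h) * ?Q * x2\<^sup>2
      + R_f * ((1 + e) * B_y C * h * ?d * ?p k + \<kappa> * h * ?Q + ?R)"
    unfolding \<kappa>_def
  proof (rule step_diff_sq_le)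
    show "quadratic_growth ?q" "quadratic_growth ?q'"
      by (rule F_quadratic_growth[OF lip] F_quadratic_growth[OF lip']; use i in simp)+
    show "(?q z1 - ?q' z2)\<^sup>2 \<le> ?p k * (z1 - z2)\<^sup>2 + ?Q * z2\<^sup>2
        + (w * H\<^sub>d + (1 + e) * (B_y C * H + B_0 C) * (h * real k) * \<mu> n * w * G\<^sub>d) * c k" for z1 z2
      using Suc.IH[OF i(2), of z1 z2] unfolding \<kappa>_def .
    show "0 \<le> (w * H\<^sub>d + (1 + e) * (B_y C * H + B_0 C) * (h * real k) * \<mu> n * w * G\<^sub>d) * c k"
      using w c \<mu>0 nonneg h_pos constants_nonneg e_pos
      by (intro mult_nonneg_nonneg add_nonneg_nonneg) auto
  qed (use young i w c \<mu>0 nonneg p growth' in auto)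
  also have "(exp ((A_f C + e + D ((1 + lam) * a)) * h) * ?p k + (1 + e) * f_x C * h) = ?p (Suc k)"
    by (simp add: profile_Suc)
  also have "?p (Suc k) * (x1 - x2)\<^sup>2 + exp ((A_f C + e + D a) * h) * ?Q * x2\<^sup>2
      + R_f * ((1 + e) * B_y C * h * ?d * ?p k + \<kappa> * h * ?Q + ?R)
    = ?p (Suc k) * (x1 - x2)\<^sup>2 + R_f * (exp (D a * h) * \<mu> k * c k + 1 * ?p k) * (w * G\<^sub>d * x2\<^sup>2)
      + R_f * (w * H\<^sub>d * (?p k + c k) + \<kappa> * h * w * G\<^sub>d * (\<mu> k * c k + real k * \<mu> n * c k))"
    by (simp add: w_def algebra_simps exp_add)
  \<comment> \<open>Both coefficients are raised to a common multiple of \<open>c k + ?p k\<close>,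
    the combination that \<open>conv_Suc\<close> turns into \<open>c (Suc k)\<close>. In the
    constant part the extra \<open>\<mu> n\<close> raises the counter from \<open>k\<close> to
    \<open>Suc k\<close>.\<close>
  also have "\<dots> \<le> ?p (Suc k) * (x1 - x2)\<^sup>2 + R_f * (\<mu> (Suc k) * c k + \<mu> (Suc k) * ?p k) * (w * G\<^sub>d * x2\<^sup>2)
      + R_f * (w * H\<^sub>d * (?p k + c k)
        + \<kappa> * h * w * G\<^sub>d * (\<mu> n * (c k + ?p k) + real k * \<mu> n * (c k + ?p k)))"
  proof -
    have 1: "exp (D a * h) * \<mu> k \<le> \<mu> (Suc k)"
    proof (cases "0 \<le> D a")
      case True
      then have "\<mu> j = exp (D a * (h * real j))" for j
        using h_pos by (simp add: \<mu>_def max_def mult_le_0_iff)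
      then show ?thesis by (simp add: algebra_simps flip: exp_add)
    next
      case False
      then have "D a * (h * real j) \<le> 0" for j
        using h_pos by (intro mult_nonpos_nonneg) auto
      then have "\<mu> j = 1" for j
        by (simp add: \<mu>_def max_def)
      then show ?thesis using False h_pos by (simp add: mult_le_0_iff)
    qed
    have 2: "\<mu> k \<le> \<mu> n"
    proof (cases "0 \<le> D a")
      case True
      then have "D a * (h * real k) \<le> D a * (h * real n)"
        using h_pos i by (intro mult_left_mono) auto
      then show ?thesis by (auto simp: \<mu>_def le_max_iff_disj)
    next
      case False
      then have "D a * (h * real k) \<le> 0" using h_pos by (simp add: mult_le_0_iff)
      then have "\<mu> k = 1" by (simp add: \<mu>_def max_def)
      then show ?thesis using \<mu> by simp
    qed
    have 3: "\<mu> k * c k \<le> \<mu> n * (c k + ?p k)"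
      using 2 c p \<mu>0 by (intro mult_mono) auto
    have 4: "real k * \<mu> n * c k \<le> real k * \<mu> n * (c k + ?p k)"
      using p \<mu>0 by (intro mult_left_mono) auto
    show ?thesis
      using w \<kappa> nonneg h_pos \<mu> p c
      by (intro add_mono order_refl mult_right_mono mult_left_mono 1 3 4) auto
  qed
  also have "\<dots> = ?p (Suc k) * (x1 - x2)\<^sup>2 + \<mu> (Suc k) * w * G\<^sub>d * c (Suc k) * x2\<^sup>2
      + (w * H\<^sub>d + \<kappa> * (h * real (Suc k)) * \<mu> n * w * G\<^sub>d) * c (Suc k)"
    unfolding c_def conv_Suc by (simp add: algebra_simps)
  finally show ?case
    unfolding F_backward[OF Suc.prems] .
qed

end

section \<open>The limit of the Markovian iteration\<close>

text \<open>All that the fixed point argument requires of the mesh: invariance with one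
  \<open>a\<close> for Lipschitz and growth bounds, contraction with factor \<open>c\<close>, and a
  contracting scalar equation for uniqueness.\<close>

locale contractive_scheme = euler_scheme M W T C b \<sigma> f g n e
  for M :: "'a measure" and W T C b \<sigma> f g n e +
  fixes a H c lam :: real
  assumes a_nonneg: "0 \<le> a" and H_nonneg: "0 \<le> H" and c_bounds: "0 < c" "c < 1" and lam_pos: "0 < lam"
    and P_le: "\<And>k. k \<le> n \<Longrightarrow> P a k \<le> a"
    and growth_profile_le: "\<And>k. k \<le> n \<Longrightarrow> growth_profile a H k \<le> H"
    and contraction_le: "\<And>k. k \<le> n \<Longrightarrow>
      max (exp (D a * T)) 1 * (1 + inverse lam) * (1 + e) * B_y C * (h * conv R_f (P ((1 + lam) * a)) k) \<le> c"
    and implicit_lt: "R_f * (1 + e) * B_y C * h * a < 1"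
begin

definition invariant :: "(nat \<Rightarrow> real \<Rightarrow> real) \<Rightarrow> bool" where
  "invariant \<phi> \<longleftrightarrow> (\<forall>i\<le>n. \<forall>x1 x2. (\<phi> i x1 - \<phi> i x2)\<^sup>2 \<le> a * (x1 - x2)\<^sup>2)
    \<and> (\<forall>i\<le>n. \<forall>x. (\<phi> i x)\<^sup>2 \<le> a * x\<^sup>2 + H)"

lemma invariantD:
  assumes "invariant \<phi>" "i \<le> n"
  shows "(\<phi> i x1 - \<phi> i x2)\<^sup>2 \<le> a * (x1 - x2)\<^sup>2" "(\<phi> i x)\<^sup>2 \<le> a * x\<^sup>2 + H"
  using assms by (auto simp: invariant_def)

lemma invariant_F:
  assumes "invariant \<phi>"
  shows "invariant (F \<phi>)"
  unfolding invariant_def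
proof (intro conjI allI impI)
  fix i assume "i \<le> n"
  then have i: "n - i \<le> n" "n - (n - i) = i" by auto
  have lip: "(\<phi> i x1 - \<phi> i x2)\<^sup>2 \<le> a * (x1 - x2)\<^sup>2" and growth: "(\<phi> i x)\<^sup>2 \<le> a * x\<^sup>2 + H" if "i < n" for i x1 x2 x
    using invariantD[OF assms, of i] that by auto
  show "(F \<phi> i x1 - F \<phi> i x2)\<^sup>2 \<le> a * (x1 - x2)\<^sup>2" for x1 x2
  proof -
    have "(F \<phi> (n - (n - i)) x1 - F \<phi> (n - (n - i)) x2)\<^sup>2 \<le> P a (n - i) * (x1 - x2)\<^sup>2"
      by (rule F_lipschitz[OF lip i(1)])
    also have "\<dots> \<le> a * (x1 - x2)\<^sup>2"
      by (rule mult_right_mono[OF P_le[OF i(1)] zero_le_power2])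
    finally show ?thesis unfolding i(2) .
  qed
  show "(F \<phi> i x)\<^sup>2 \<le> a * x\<^sup>2 + H" for x
  proof -
    have "(F \<phi> (n - (n - i)) x)\<^sup>2 \<le> P a (n - i) * x\<^sup>2 + growth_profile a H (n - i)"
      by (rule F_growth[OF lip growth H_nonneg i(1)])
    also have "\<dots> \<le> a * x\<^sup>2 + H"
      by (rule add_mono[OF mult_right_mono[OF P_le[OF i(1)] zero_le_power2] growth_profile_le[OF i(1)]])
    finally show ?thesis unfolding i(2) .
  qed
qed

definition \<kappa> :: real where "\<kappa> = (1 + e) * (B_y C * H + B_0 C)"

lemma \<kappa>_nonneg: "0 \<le> \<kappa>"
  using constants_nonneg e_pos H_nonneg by (simp add: \<kappa>_def)

text \<open>On the diagonal the \<open>P\<close> term vanishes. The pair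
  \<open>(G\<^sub>d, H\<^sub>d)\<close> is mapped to
  \<open>(c G\<^sub>d, c (H\<^sub>d + \<kappa> T G\<^sub>d))\<close>.\<close>

lemma F_diff_le:
  assumes "invariant \<phi>" "invariant \<phi>'" "0 \<le> G\<^sub>d" "0 \<le> H\<^sub>d" "i \<le> n"
    and "\<And>i x. i \<le> n \<Longrightarrow> (\<phi> i x - \<phi>' i x)\<^sup>2 \<le> G\<^sub>d * x\<^sup>2 + H\<^sub>d"
  shows "(F \<phi> i x - F \<phi>' i x)\<^sup>2 \<le> c * G\<^sub>d * x\<^sup>2 + c * (H\<^sub>d + \<kappa> * T * G\<^sub>d)"
proof -
  define k where "k = n - i"
  have k: "k \<le> n" "n - k = i" using assms(5) by (auto simp: k_def)
  define w where "w = (1 + inverse lam) * (1 + e) * B_y C * h"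
  define q where "q = conv R_f (P ((1 + lam) * a)) k"
  define \<mu> where "\<mu> j = max (exp (D a * (h * real j))) 1" for j
  define t where "t = h * real k"
  have w: "0 \<le> w"
    using constants_nonneg(5) e_pos h_pos lam_pos unfolding w_def by (intro mult_nonneg_nonneg) auto
  have q: "0 \<le> q"
    unfolding q_def by (intro conv_nonneg P_nonneg) simp
  have wq: "0 \<le> w * q" using w q by simp
  have n: "\<mu> n * (w * q) \<le> c"
    using contraction_le[OF k(1)] unfolding \<mu>_def w_def q_def hn by (simp only: mult_ac)
  have t: "0 \<le> t" "t \<le> T"
    using k(1) h_pos mult_left_mono[of "real k" "real n" h] unfolding hn t_def by simp_all
  have \<mu>: "\<mu> k \<le> \<mu> n"
  proof (cases "0 \<le> D a")
    case True
    then have "D a * t \<le> D a * T" by (intro mult_left_mono t)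
    then show ?thesis unfolding \<mu>_def hn t_def[symmetric] by (intro max.mono) auto
  next
    case False
    then have "D a * t \<le> 0" using t by (intro mult_nonpos_nonneg) auto
    then show ?thesis unfolding \<mu>_def t_def[symmetric] by (simp add: le_max_iff_disj)
  qed
  have 1: "\<mu> k * (w * q) \<le> c"
    using mult_right_mono[OF \<mu> wq] n by linarith
  have "1 \<le> \<mu> n" by (simp add: \<mu>_def)
  then have 2: "w * q \<le> c"
    using mult_right_mono[OF _ wq, of 1 "\<mu> n"] n by linarith
  have "t * (\<mu> n * (w * q)) \<le> T * c"
    using t n wq \<open>1 \<le> \<mu> n\<close> T_pos by (intro mult_mono mult_nonneg_nonneg w q) auto
  then have 3: "\<kappa> * G\<^sub>d * (t * (\<mu> n * (w * q))) \<le> \<kappa> * G\<^sub>d * (T * c)"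
    using \<kappa>_nonneg assms(3) by (intro mult_left_mono) auto
  have "(F \<phi> (n - k) x - F \<phi>' (n - k) x)\<^sup>2 \<le> P ((1 + lam) * a) k * (x - x)\<^sup>2
      + \<mu> k * w * G\<^sub>d * q * x\<^sup>2 + (w * H\<^sub>d + \<kappa> * t * \<mu> n * w * G\<^sub>d) * q"
    unfolding \<mu>_def w_def q_def \<kappa>_def t_def
  proof (rule F_contraction)
    fix i and x1 x2 x :: real assume "i < n"
    then have "i \<le> n" by simp
    then show "(\<phi> i x1 - \<phi> i x2)\<^sup>2 \<le> a * (x1 - x2)\<^sup>2" "(\<phi>' i x1 - \<phi>' i x2)\<^sup>2 \<le> a * (x1 - x2)\<^sup>2"
      "(\<phi>' i x)\<^sup>2 \<le> a * x\<^sup>2 + H" "(\<phi> i x - \<phi>' i x)\<^sup>2 \<le> G\<^sub>d * x\<^sup>2 + H\<^sub>d"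
      by (rule invariantD[OF assms(1)] invariantD[OF assms(2)] assms(6))+
  qed (rule H_nonneg assms(3,4) lam_pos k(1))+
  also have "\<dots> = (\<mu> k * (w * q)) * (G\<^sub>d * x\<^sup>2) + (w * q) * H\<^sub>d + \<kappa> * G\<^sub>d * (t * (\<mu> n * (w * q)))"
    by (simp add: algebra_simps)
  also have "\<dots> \<le> c * (G\<^sub>d * x\<^sup>2) + c * H\<^sub>d + \<kappa> * G\<^sub>d * (T * c)"
    using assms(3,4) by (intro add_mono mult_right_mono 1 2 3) auto
  finally show ?thesis unfolding k(2) by (simp add: algebra_simps)
qed

abbreviation iter :: "nat \<Rightarrow> nat \<Rightarrow> real \<Rightarrow> real" where
  "iter \<equiv> markov_iter M W T b \<sigma> f g n"

lemma invariant_iter: "invariant (iter m)"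
proof (induction m)
  case 0
  then show ?case using a_nonneg H_nonneg by (simp add: invariant_def)
next
  case (Suc m)
  then show ?case by (simp add: invariant_F)
qed

text \<open>The \<open>m\<close>-th power of the triangular map of \<open>F_diff_le\<close>, applied
  to the pair \<open>(a, H)\<close>.\<close>

definition rate :: "nat \<Rightarrow> real \<Rightarrow> real" where
  "rate m x = c ^ m * a * x\<^sup>2 + c ^ m * (H + real m * \<kappa> * T * a)"

lemma rate_tendsto: "(\<lambda>m. rate m x) \<longlonglongrightarrow> 0"
proof -
  have "(\<lambda>m. c ^ m) \<longlonglongrightarrow> 0" "(\<lambda>m. real m * c ^ m) \<longlonglongrightarrow> 0"
    using c_bounds LIMSEQ_power_zero[of c] powser_times_n_limit_0[of c] by auto
  then have "(\<lambda>m. c ^ m * (a * x\<^sup>2 + H) + real m * c ^ m * (\<kappa> * T * a)) \<longlonglongrightarrow> 0 * (a * x\<^sup>2 + H) + 0 * (\<kappa> * T * a)"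
    by (intro tendsto_add tendsto_mult_right)
  moreover have "rate m x = c ^ m * (a * x\<^sup>2 + H) + real m * c ^ m * (\<kappa> * T * a)" for m
    by (simp add: rate_def algebra_simps)
  ultimately show ?thesis by simp
qed

text \<open>Stages \<open>m + k\<close> and \<open>m\<close> are compared directly: the induction
  starts from stage \<open>k\<close> against 0, which is bounded by invariance. No series of
  consecutive differences is summed, so no factor \<open>1 / (1 - sqrt c)\<close> arises.\<close>

lemma iter_diff_le:
  assumes "i \<le> n"
  shows "(iter (m + k) i x - iter m i x)\<^sup>2 \<le> rate m x"
  using assms
proof (induction m arbitrary: i x)
  case 0
  then show ?case using invariantD(2)[OF invariant_iter] by (simp add: rate_def)
next
  case (Suc m)
  have "(F (iter (m + k)) i x - F (iter m) i x)\<^sup>2 \<le> c * (c ^ m * a) * x\<^sup>2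
      + c * (c ^ m * (H + real m * \<kappa> * T * a) + \<kappa> * T * (c ^ m * a))"
    by (rule F_diff_le)
      (use Suc invariant_iter c_bounds a_nonneg H_nonneg \<kappa>_nonneg T_pos in \<open>auto simp: rate_def\<close>)
  then show ?case by (simp add: rate_def algebra_simps)
qed

text \<open>The limit does not mention \<open>a\<close>, \<open>H\<close>, \<open>c\<close>,
  \<open>lam\<close> or \<open>e\<close>, so different choices of these parameters give the same
  solution.\<close>

definition u :: "nat \<Rightarrow> real \<Rightarrow> real" where
  "u i x = lim (\<lambda>m. iter m i x)"

lemma iter_tendsto:
  assumes "i \<le> n"
  shows "(\<lambda>m. iter m i x) \<longlonglongrightarrow> u i x"
proof -
  have "Cauchy (\<lambda>m. iter m i x)"
  proof (rule metric_CauchyI)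
    fix r :: real assume "0 < r"
    then have "\<forall>\<^sub>F m in sequentially. rate m x < r\<^sup>2"
      by (intro order_tendstoD(2)[OF rate_tendsto]) simp
    then obtain N where N: "\<And>m. N \<le> m \<Longrightarrow> rate m x < r\<^sup>2"
      by (auto simp: eventually_sequentially)
    have *: "dist (iter (m + k) i x) (iter m i x) < r" if "N \<le> m" for m k
    proof -
      have "(iter (m + k) i x - iter m i x)\<^sup>2 < r\<^sup>2"
        using iter_diff_le[OF assms] N[OF that] by (rule le_less_trans)
      then show ?thesis
        using \<open>0 < r\<close> power2_less_imp_less[of "\<bar>iter (m + k) i x - iter m i x\<bar>" r]
        by (simp add: dist_real_def)
    qed
    show "\<exists>N. \<forall>m\<ge>N. \<forall>k\<ge>N. dist (iter m i x) (iter k i x) < r"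
    proof (intro exI allI impI)
      fix m k assume "N \<le> m" "N \<le> k"
      then show "dist (iter m i x) (iter k i x) < r"
        using *[of m "k - m"] *[of k "m - k"] by (cases "m \<le> k") (auto simp: dist_commute)
    qed
  qed
  then show ?thesis by (simp add: u_def Cauchy_convergent convergent_LIMSEQ_iff[symmetric])
qed

lemma u_diff_le:
  assumes "i \<le> n"
  shows "(u i x - iter m i x)\<^sup>2 \<le> rate m x"
proof (rule tendsto_upperbound)
  show "((\<lambda>k. (iter (k + m) i x - iter m i x)\<^sup>2) \<longlongrightarrow> (u i x - iter m i x)\<^sup>2) sequentially"
    by (intro tendsto_intros LIMSEQ_ignore_initial_segment iter_tendsto assms)
  show "\<forall>\<^sub>F k in sequentially. (iter (k + m) i x - iter m i x)\<^sup>2 \<le> rate m x"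
    by (rule always_eventually, rule allI, subst add.commute, rule iter_diff_le[OF assms])
qed simp

lemma invariant_u: "invariant u"
  unfolding invariant_def
proof (intro conjI allI impI)
  fix i assume i: "i \<le> n"
  show "(u i x1 - u i x2)\<^sup>2 \<le> a * (x1 - x2)\<^sup>2" for x1 x2
    by (rule tendsto_upperbound[where f = "\<lambda>m. (iter m i x1 - iter m i x2)\<^sup>2" and F = sequentially])
      (use i invariantD[OF invariant_iter] in \<open>auto intro!: tendsto_intros iter_tendsto\<close>)
  show "(u i x)\<^sup>2 \<le> a * x\<^sup>2 + H" for x
    by (rule tendsto_upperbound[where f = "\<lambda>m. (iter m i x)\<^sup>2" and F = sequentially])
      (use i invariantD[OF invariant_iter] in \<open>auto intro!: tendsto_intros iter_tendsto\<close>)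
qed

text \<open>The contraction estimate replaces an interchange of limit and expectation:
  \<open>F u\<close> and \<open>u\<close> are both limits of the shifted iterates.\<close>

lemma F_u:
  assumes "i \<le> n"
  shows "F u i = u i"
proof (rule ext)
  fix x
  let ?r = "\<lambda>m. c * (c ^ m * a) * x\<^sup>2 + c * (c ^ m * (H + real m * \<kappa> * T * a) + \<kappa> * T * (c ^ m * a))"
  have r: "?r m = rate (Suc m) x" for m
    by (simp add: rate_def algebra_simps)
  have "(F u i x - iter (Suc m) i x)\<^sup>2 \<le> rate (Suc m) x" for m
    unfolding r[symmetric] markov_iter.simps
    by (rule F_diff_le)
      (use assms u_diff_le invariant_iter invariant_u c_bounds a_nonneg H_nonneg \<kappa>_nonneg T_pos in \<open>auto simp: rate_def\<close>)
  then have "(F u i x - u i x)\<^sup>2 \<le> 0"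
    using LIMSEQ_Suc[OF rate_tendsto[of x]] LIMSEQ_Suc[OF iter_tendsto[OF assms, of x]]
    by (intro LIMSEQ_le[where X = "\<lambda>m. (F u i x - iter (Suc m) i x)\<^sup>2"]) (auto intro!: tendsto_intros simp del: markov_iter.simps)
  then show "F u i x = u i x" by simp
qed

lemma u_measurable: "i \<le> n \<Longrightarrow> u i \<in> borel_measurable borel"
  using quadratic_growth_of_lipschitz[OF a_nonneg invariantD(1)[OF invariant_u]]
  by (simp add: quadratic_growth_def)

lemma solves_u: "solves_R M W T b \<sigma> f g n u"
  unfolding solves_R_def
proof (intro conjI allI impI)
  show "u n = g" using F_u[of n] F_terminal by simp
  fix i x assume i: "i < n"
  have "u i = S i (u i) (F u (Suc i))"
    using F_u[of i] i by (simp add: F_op.simps[of _ _ _ _ _ _ _ _ _ i])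
  then show "u i x = S i (u i) (u (Suc i)) x"
    using F_u[of "Suc i"] i by simp
qed (rule u_measurable)

lemma solution_unique:
  assumes v: "solves_R M W T b \<sigma> f g n v" and "i \<le> n"
  shows "v i = u i"
  using assms(2)
proof (induction i rule: inc_induct)
  case base
  then show ?case using v solves_u by (simp add: solves_R_def)
next
  case (step i)
  show ?case
  proof (rule ext)
    fix x
    let ?d = "(v i x - u i x)\<^sup>2" and ?q = "u (Suc i)"
    have q: "quadratic_growth ?q"
      by (rule quadratic_growth_of_lipschitz[OF a_nonneg invariantD(1)[OF invariant_u]]) (use step in simp)
    \<comment> \<open>With both base points equal to \<open>x\<close> and \<open>d = ?d\<close>, the
      squared difference of the two candidate values reappears on the right, with the factor that
      \<open>implicit_lt\<close> keeps below 1.\<close>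
    have "(S i (v i) ?q x - S i (u i) ?q x)\<^sup>2 \<le>
        (exp ((A_f C + e + D 0) * h) * a + (1 + e) * f_x C * h) * (x - x)\<^sup>2
        + exp ((A_f C + e + D 0) * h) * 0 * x\<^sup>2
        + R_f * ((1 + e) * B_y C * h * ?d * a + (1 + e) * (B_y C * (u i x)\<^sup>2 + B_0 C) * h * 0 + 0)"
      by (rule step_diff_sq_le) (use step q a_nonneg invariantD(1)[OF invariant_u] in auto)
    moreover have "v i x = S i (v i) ?q x" "u i x = S i (u i) ?q x"
      using v solves_u step by (auto simp: solves_R_def)
    ultimately have "?d \<le> (R_f * (1 + e) * B_y C * h * a) * ?d"
      by (simp add: mult_ac)
    then have "(1 - R_f * (1 + e) * B_y C * h * a) * ?d \<le> 0"
      by (simp add: left_diff_distrib)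
    then show "v i x = u i x"
      using implicit_lt by (simp add: mult_le_0_iff)
  qed
qed

end

section \<open>Small mesh sizes\<close>

lemma c0_fun_eq: "c0_fun T C G = kernel T (g_x C) (f_x C) (A_f C) (A_b C + B_y C * G)"
  by (simp add: c0_fun_def kernel_def A_f_def A_b_def B_y_def distrib_right)

lemma c2_at_eq: "c2_at T C lam L G = max (exp ((A_b C + B_y C * G) * T)) 1 * (1 + inverse lam) * B_y C
    * kernel T (g_x C) (f_x C) (A_f C) (A_b C + B_y C * ((1 + lam) * L))"
  by (simp add: c2_at_def kernel_def A_f_def A_b_def B_y_def mult_ac)

lemma L2_fun_eq: "L2_fun T C G = exp (max (A_f C) 0 * T) * g_0 C + f_0 C * T * \<Gamma>0 (A_f C * T) + B_0 C * c0_fun T C G"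
  by (simp add: L2_fun_def A_f_def B_0_def)

text \<open>With \<open>\<gamma> = g_x + f_x T\<close> and \<open>Z\<close> the right-hand side, the product \<open>B_y L1 T\<close> is \<open>B_y \<gamma> T\<close> if \<open>Z \<le> 0\<close>
  and \<open>exp 1 L0 < 1\<close> otherwise. The strict inequality leaves room for the discretization errors.\<close>

lemma L1_exponent_less:
  assumes "L0 T C < exp (- 1)" "0 < T" "0 \<le> B_y C" "0 \<le> g_x C" "0 \<le> f_x C"
  shows "(A_f C + (A_b C + B_y C * L1 T C)) * T < B_y C * (g_x C + f_x C * T) * T + (A_f C + A_b C) * T + 1"
proof -
  define \<gamma> where "\<gamma> = g_x C + f_x C * T"
  define s where "s = B_y C * \<gamma> * T + (A_f C + A_b C) * T"
  have \<gamma>: "0 \<le> B_y C * \<gamma> * T" using assms by (simp add: \<gamma>_def)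
  have e: "2 * k_b C + 2 * k_f C + 2 + \<sigma>_x C + f_z C = A_f C + A_b C"
    by (simp add: A_f_def A_b_def)
  have L0: "L0 T C = B_y C * \<gamma> * T * exp s"
    by (simp add: L0_def s_def \<gamma>_def B_y_def e[unfolded B_y_def])
  have L1: "L1 T C = \<gamma> * max (exp (s + 1)) 1"
    by (simp add: L1_def s_def \<gamma>_def B_y_def e[unfolded B_y_def])
  have "B_y C * L1 T C * T < B_y C * \<gamma> * T + 1"
  proof (cases "s + 1 \<le> 0")
    case True
    then show ?thesis by (simp add: L1 max_def)
  next
    case False
    then have "max (exp (s + 1)) 1 = exp (s + 1)"
      by (intro max_absorb1) simp
    then have "B_y C * L1 T C * T = L0 T C * exp 1"
      by (simp add: L0 L1 exp_add)
    also have "\<dots> < exp (- 1) * exp 1"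
      using assms(1) by simp
    also have "\<dots> = 1" by (simp flip: exp_add)
    finally show ?thesis using \<gamma> by simp
  qed
  then show ?thesis by (simp add: \<gamma>_def algebra_simps)
qed

section \<open>Discrete bounds in terms of the continuous-time constants\<close>

context euler_scheme
begin

text \<open>The kernel is taken at a reference rate \<open>D0\<close> without perturbation; all
  errors sit in factors that tend to 1 when \<open>e\<close> and \<open>d\<close> tend to 0 with
  \<open>D a\<close> bounded.\<close>

lemma conv_P_le:
  assumes "\<bar>D a - D0\<bar> \<le> d" "k \<le> n"
  shows "h * conv R_f (P a) k \<le> exp ((\<bar>A_f C + e\<bar> + \<bar>D a\<bar>) * e)
    * ((1 + e) * exp ((e + d) * T) * kernel T (g_x C) (f_x C) (A_f C) D0)"
proof -
  have "h * conv R_f (P a) k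
      \<le> exp ((\<bar>A_f C + e\<bar> + \<bar>D a\<bar>) * h) * kernel T (g_x C) ((1 + e) * f_x C) (A_f C + e) (D a)"
    using constants_nonneg e_pos by (intro conv_profile_le[OF T_pos n_pos assms(2)] h_def) auto
  also have "\<dots> \<le> exp ((\<bar>A_f C + e\<bar> + \<bar>D a\<bar>) * e)
    * ((1 + e) * exp ((e + d) * T) * kernel T (g_x C) (f_x C) (A_f C) D0)"
    using constants_nonneg e_pos T_pos assms(1) h_le
    by (intro mult_mono kernel_shift_le kernel_nonneg) (auto intro!: mult_left_mono)
  finally show ?thesis .
qed

lemma P_le_of_exponent:
  assumes "(A_f C + e + D a) * T \<le> Z" "k \<le> n"
  shows "P a k \<le> (g_x C + (1 + e) * f_x C * T) * max (exp Z) 1"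
proof -
  define t where "t = h * real k"
  have t: "0 \<le> t" "t \<le> T"
    using assms(2) h_pos mult_left_mono[of "real k" "real n" h] unfolding hn t_def by simp_all
  have "exp ((A_f C + e + D a) * t) \<le> max (exp Z) 1"
  proof (cases "0 \<le> A_f C + e + D a")
    case True
    then have "(A_f C + e + D a) * t \<le> (A_f C + e + D a) * T" by (intro mult_left_mono t)
    then show ?thesis using assms(1) by (simp add: le_max_iff_disj)
  next
    case False
    then have "(A_f C + e + D a) * t \<le> 0" using t by (intro mult_nonpos_nonneg) auto
    then show ?thesis by (simp add: le_max_iff_disj)
  qed
  then have m: "max (exp ((A_f C + e + D a) * t)) 1 \<le> max (exp Z) 1" by simp
  have "P a k \<le> (g_x C + (1 + e) * f_x C * t) * max (exp ((A_f C + e + D a) * t)) 1"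
    unfolding t_def using constants_nonneg e_pos h_pos by (intro profile_le) auto
  also have "\<dots> \<le> (g_x C + (1 + e) * f_x C * T) * max (exp Z) 1"
    using constants_nonneg e_pos t m
    by (intro mult_mono add_left_mono mult_left_mono add_nonneg_nonneg mult_nonneg_nonneg) auto
  finally show ?thesis .
qed

lemma growth_profile_le_of_conv:
  assumes "k \<le> n" "0 \<le> H" and conv: "h * conv R_f (P a) k \<le> q"
  shows "growth_profile a H k \<le> exp (max (A_f C + e) 0 * T) * g_0 C
    + (1 + e) * f_0 C * (T * (exp (e * T) * \<Gamma>0 (A_f C * T)) * exp (\<bar>A_f C + e\<bar> * e))
    + (1 + e) * (B_y C * H + B_0 C) * q"
proof -
  define t where "t = h * real k"
  have t: "0 \<le> t" "t \<le> T"
    using assms(1) h_pos mult_left_mono[of "real k" "real n" h] unfolding hn t_def by simp_all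
  have "(A_f C + e) * t \<le> max (A_f C + e) 0 * T"
    using t by (intro mult_mono) auto
  then have "R_f ^ k \<le> exp (max (A_f C + e) 0 * T)"
    by (simp add: t_def mult_ac flip: exp_of_nat_mult)
  then have 1: "R_f ^ k * g_0 C \<le> exp (max (A_f C + e) 0 * T) * g_0 C"
    using constants_nonneg by (intro mult_right_mono)
  have "h * (\<Sum>j<k. R_f ^ j) \<le> T * \<Gamma>0 ((A_f C + e) * T) * exp (\<bar>A_f C + e\<bar> * h)"
    by (rule sum_exp_le[OF T_pos n_pos assms(1) h_def])
  also have "\<dots> \<le> T * (exp (e * T) * \<Gamma>0 (A_f C * T)) * exp (\<bar>A_f C + e\<bar> * e)"
    using T_pos e_pos h_le \<Gamma>0_pos[THEN less_imp_le]
    by (intro mult_mono \<Gamma>0_shift_le mult_nonneg_nonneg) (auto simp: distrib_right intro!: mult_left_mono)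
  finally have 2: "(1 + e) * f_0 C * (h * (\<Sum>j<k. R_f ^ j))
      \<le> (1 + e) * f_0 C * (T * (exp (e * T) * \<Gamma>0 (A_f C * T)) * exp (\<bar>A_f C + e\<bar> * e))"
    using constants_nonneg e_pos by (intro mult_left_mono) auto
  have 3: "(1 + e) * (B_y C * H + B_0 C) * (h * conv R_f (P a) k) \<le> (1 + e) * (B_y C * H + B_0 C) * q"
    using constants_nonneg e_pos assms(2) by (intro mult_left_mono conv) auto
  show ?thesis
    unfolding growth_profile_def using 1 2 3 by (simp only: mult.assoc)
qed

end

text \<open>The choice has two stages. As \<open>e\<close> tends to 0 each perturbed constant tends
  to its continuous-time value, so the strict hypotheses hold for some fixed \<open>e\<close>; only
  then is the mesh made small relative to this \<open>e\<close>. Thus \<open>e\<close> and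
  \<open>a\<close> are the same for all admissible \<open>n\<close>.\<close>

lemma contractive_scheme_for_small_mesh:
  fixes M :: "'a measure"
  assumes T: "0 < T" and bm: "brownian_motion M W T" and coeff: "standing_assumption T C b \<sigma> f g"
    and L0: "L0 T C < exp (- 1)" and lam: "0 < lam"
    and c2: "c2_at T C lam (L1 T C) (L1 T C) < c2" "c2 < 1"
    and Lbar: "L1 T C < Lbar" and L2: "L2_fun T C (L1 T C) < L2"
    and c1: "c1_fun T C (L1 T C) < c1" "c1 < 1" and H: "H = L2 / (1 - c1)"
  shows "\<exists>e a h0. e \<le> 1 \<and> a \<le> Lbar \<and> 0 < h0 \<and>
    (\<forall>n\<ge>1. T / real n \<le> h0 \<longrightarrow> contractive_scheme M W T C b \<sigma> f g n e a H c2 lam)"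
proof -
  have nonneg: "0 \<le> g_x C" "0 \<le> f_x C" "0 \<le> g_0 C" "0 \<le> f_0 C" "0 \<le> B_y C" "0 \<le> B_0 C" "0 \<le> K_ub C" "0 \<le> f_z C"
    using coeff by (auto simp: standing_assumption_def B_y_def B_0_def)
  define L where "L = L1 T C"
  define Z where "Z = B_y C * (g_x C + f_x C * T) * T + (A_f C + A_b C) * T + 1"
  define m where "m = max (exp Z) 1"
  \<comment> \<open>This slope makes \<open>\<alpha> e\<close> a margin for the self-referential
    bound: \<open>(g_x + (1 + e) f_x T) m = L + f_x T m e \<le> \<alpha> e\<close>. Raising
    \<open>a\<close> from \<open>L\<close> to \<open>\<alpha> e\<close> also raises the exponent,
    but by the strict inequality it stays below \<open>Z\<close>, so \<open>m\<close> is
    unaffected.\<close>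
  define r where "r = 1 + f_x C * T * m"
  define \<alpha> where "\<alpha> e = L + r * e" for e
  define D1 where "D1 e = A_b C + e + (1 + e) * B_y C * \<alpha> e" for e
  define D2 where "D2 e = A_b C + e + (1 + e) * B_y C * ((1 + lam) * \<alpha> e)" for e
  define k1 where "k1 = kernel T (g_x C) (f_x C) (A_f C) (D1 0)"
  define k2 where "k2 = kernel T (g_x C) (f_x C) (A_f C) (D2 0)"
  define q1 where "q1 e = exp ((\<bar>A_f C + e\<bar> + \<bar>D1 e\<bar>) * e) * ((1 + e) * exp ((e + \<bar>D1 e - D1 0\<bar>) * T) * k1)" for e
  define q2 where "q2 e = exp ((\<bar>A_f C + e\<bar> + \<bar>D2 e\<bar>) * e) * ((1 + e) * exp ((e + \<bar>D2 e - D2 0\<bar>) * T) * k2)" for e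
  have L_eq: "L = (g_x C + f_x C * T) * m"
    by (simp add: L_def L1_def m_def Z_def A_f_def A_b_def B_y_def algebra_simps)
  have m: "1 \<le> m" by (simp add: m_def)
  have L_nonneg: "0 \<le> L" using nonneg T m by (simp add: L_eq)
  have k: "0 \<le> k1" "0 \<le> k2"
    unfolding k1_def k2_def using nonneg T by (auto intro!: kernel_nonneg)
  have c0: "c0_fun T C L = k1" by (simp add: c0_fun_eq k1_def D1_def \<alpha>_def)
  have lims: "(\<alpha> \<longlongrightarrow> L) (at_right 0)" "(D1 \<longlongrightarrow> D1 0) (at_right 0)" "(D2 \<longlongrightarrow> D2 0) (at_right 0)"
  proof -
    have "((\<lambda>e. L + r * e) \<longlongrightarrow> L + r * 0) (at_right 0)"
      by (intro tendsto_intros)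
    then show \<alpha>: "(\<alpha> \<longlongrightarrow> L) (at_right 0)" by (simp add: \<alpha>_def[abs_def])
    have "((\<lambda>e. A_b C + e + (1 + e) * B_y C * \<alpha> e) \<longlongrightarrow> A_b C + 0 + (1 + 0) * B_y C * L) (at_right 0)"
      by (intro tendsto_intros \<alpha>)
    then show "(D1 \<longlongrightarrow> D1 0) (at_right 0)" by (simp add: D1_def[abs_def] \<alpha>_def)
    have "((\<lambda>e. A_b C + e + (1 + e) * B_y C * ((1 + lam) * \<alpha> e))
        \<longlongrightarrow> A_b C + 0 + (1 + 0) * B_y C * ((1 + lam) * L)) (at_right 0)"
      by (intro tendsto_intros \<alpha>)
    then show "(D2 \<longlongrightarrow> D2 0) (at_right 0)" by (simp add: D2_def[abs_def] \<alpha>_def)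
  qed
  have q1_lim: "(q1 \<longlongrightarrow> k1) (at_right 0)"
  proof -
    have "((\<lambda>e. exp ((\<bar>A_f C + e\<bar> + \<bar>D1 e\<bar>) * e) * ((1 + e) * exp ((e + \<bar>D1 e - D1 0\<bar>) * T) * k1))
      \<longlongrightarrow> exp ((\<bar>A_f C + 0\<bar> + \<bar>D1 0\<bar>) * 0) * ((1 + 0) * exp ((0 + \<bar>D1 0 - D1 0\<bar>) * T) * k1)) (at_right 0)"
      by (intro tendsto_intros lims)
    then show ?thesis by (simp add: q1_def[abs_def])
  qed
  have q2_lim: "(q2 \<longlongrightarrow> k2) (at_right 0)"
  proof -
    have "((\<lambda>e. exp ((\<bar>A_f C + e\<bar> + \<bar>D2 e\<bar>) * e) * ((1 + e) * exp ((e + \<bar>D2 e - D2 0\<bar>) * T) * k2))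
      \<longlongrightarrow> exp ((\<bar>A_f C + 0\<bar> + \<bar>D2 0\<bar>) * 0) * ((1 + 0) * exp ((0 + \<bar>D2 0 - D2 0\<bar>) * T) * k2)) (at_right 0)"
      by (intro tendsto_intros lims)
    then show ?thesis by (simp add: q2_def[abs_def])
  qed
  have "\<forall>\<^sub>F e in at_right 0. (A_f C + e + D1 e) * T < Z"
  proof (rule order_tendstoD(2))
    show "((\<lambda>e. (A_f C + e + D1 e) * T) \<longlongrightarrow> (A_f C + 0 + D1 0) * T) (at_right 0)"
      by (intro tendsto_intros lims)
    show "(A_f C + 0 + D1 0) * T < Z"
      using L1_exponent_less[OF L0 T nonneg(5,1,2)] by (simp add: Z_def D1_def \<alpha>_def L_def)
  qed
  moreover have "\<forall>\<^sub>F e in at_right 0. exp (max (A_f C + e) 0 * T) * g_0 C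
    + (1 + e) * f_0 C * (T * (exp (e * T) * \<Gamma>0 (A_f C * T)) * exp (\<bar>A_f C + e\<bar> * e))
    + (1 + e) * B_0 C * q1 e < L2"
  proof (rule order_tendstoD(2))
    show "((\<lambda>e. exp (max (A_f C + e) 0 * T) * g_0 C
        + (1 + e) * f_0 C * (T * (exp (e * T) * \<Gamma>0 (A_f C * T)) * exp (\<bar>A_f C + e\<bar> * e))
        + (1 + e) * B_0 C * q1 e)
      \<longlongrightarrow> exp (max (A_f C + 0) 0 * T) * g_0 C
        + (1 + 0) * f_0 C * (T * (exp (0 * T) * \<Gamma>0 (A_f C * T)) * exp (\<bar>A_f C + 0\<bar> * 0))
        + (1 + 0) * B_0 C * k1) (at_right 0)"
      by (intro tendsto_intros tendsto_max q1_lim)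
    show "exp (max (A_f C + 0) 0 * T) * g_0 C
        + (1 + 0) * f_0 C * (T * (exp (0 * T) * \<Gamma>0 (A_f C * T)) * exp (\<bar>A_f C + 0\<bar> * 0))
        + (1 + 0) * B_0 C * k1 < L2"
      using L2 unfolding L2_fun_eq L_def[symmetric] c0 by (simp add: mult.assoc)
  qed
  moreover have "\<forall>\<^sub>F e in at_right 0. (1 + e) * B_y C * q1 e < c1"
  proof (rule order_tendstoD(2))
    show "((\<lambda>e. (1 + e) * B_y C * q1 e) \<longlongrightarrow> (1 + 0) * B_y C * k1) (at_right 0)"
      by (intro tendsto_intros q1_lim)
    show "(1 + 0) * B_y C * k1 < c1"
      using c1(1) unfolding c1_fun_def L_def[symmetric] c0 by (simp add: B_y_def)
  qed
  moreover have "\<forall>\<^sub>F e in at_right 0. max (exp (D1 e * T)) 1 * (1 + inverse lam) * (1 + e) * B_y C * q2 e < c2"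
  proof (rule order_tendstoD(2))
    show "((\<lambda>e. max (exp (D1 e * T)) 1 * (1 + inverse lam) * (1 + e) * B_y C * q2 e)
      \<longlongrightarrow> max (exp (D1 0 * T)) 1 * (1 + inverse lam) * (1 + 0) * B_y C * k2) (at_right 0)"
      by (intro tendsto_intros tendsto_max lims q2_lim)
    show "max (exp (D1 0 * T)) 1 * (1 + inverse lam) * (1 + 0) * B_y C * k2 < c2"
      using c2(1) unfolding c2_at_eq L_def[symmetric] by (simp add: k2_def D2_def D1_def \<alpha>_def)
  qed
  moreover have "\<forall>\<^sub>F e in at_right 0. \<alpha> e < Lbar"
    by (rule order_tendstoD(2)[OF lims(1)]) (use Lbar in \<open>simp add: L_def\<close>)
  moreover have "\<forall>\<^sub>F e in at_right 0. e \<in> {0<..<(1::real)}"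
    by (rule eventually_at_right_real) simp
  ultimately have "\<forall>\<^sub>F e in at_right 0. (A_f C + e + D1 e) * T < Z \<and>
    exp (max (A_f C + e) 0 * T) * g_0 C
      + (1 + e) * f_0 C * (T * (exp (e * T) * \<Gamma>0 (A_f C * T)) * exp (\<bar>A_f C + e\<bar> * e))
      + (1 + e) * B_0 C * q1 e < L2 \<and>
    (1 + e) * B_y C * q1 e < c1 \<and>
    max (exp (D1 e * T)) 1 * (1 + inverse lam) * (1 + e) * B_y C * q2 e < c2 \<and> \<alpha> e < Lbar \<and> e \<in> {0<..<1}"
    by eventually_elim auto
  from eventually_happens'[OF trivial_limit_at_right_real this] obtain e where e: "(A_f C + e + D1 e) * T < Z"
    "exp (max (A_f C + e) 0 * T) * g_0 C
      + (1 + e) * f_0 C * (T * (exp (e * T) * \<Gamma>0 (A_f C * T)) * exp (\<bar>A_f C + e\<bar> * e))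
      + (1 + e) * B_0 C * q1 e < L2"
    "(1 + e) * B_y C * q1 e < c1"
    "max (exp (D1 e * T)) 1 * (1 + inverse lam) * (1 + e) * B_y C * q2 e < c2" "\<alpha> e < Lbar" "0 < e" "e < 1"
    by auto
  let ?a = "\<alpha> e"
  have a: "0 \<le> ?a" using L_nonneg nonneg T m e(6) by (simp add: \<alpha>_def r_def)
  have q_nonneg: "0 \<le> q1 e" "0 \<le> q2 e" using k e(6) by (auto simp: q1_def q2_def)
  have L2_pos: "0 < L2"
  proof -
    have "0 \<le> L2_fun T C (L1 T C)"
      using nonneg T k \<Gamma>0_pos[THEN less_imp_le] unfolding L2_fun_eq L_def[symmetric] c0 by simp
    then show ?thesis using L2 by simp
  qed
  have H_nonneg: "0 \<le> H" using L2_pos c1(2) by (simp add: H)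
  have c2_pos: "0 < c2"
  proof -
    have "0 \<le> max (exp (D1 e * T)) 1 * (1 + inverse lam) * (1 + e) * B_y C * q2 e"
      using nonneg lam e(6) q_nonneg by (simp add: le_max_iff_disj)
    then show ?thesis using e(4) by linarith
  qed
  have "\<forall>\<^sub>F h in at_right 0. exp ((A_f C + e) * h) * (1 + e) * B_y C * h * ?a < 1"
  proof (rule order_tendstoD(2))
    show "((\<lambda>h. exp ((A_f C + e) * h) * (1 + e) * B_y C * h * ?a)
      \<longlongrightarrow> exp ((A_f C + e) * 0) * (1 + e) * B_y C * 0 * ?a) (at_right 0)"
      by (intro tendsto_intros)
  qed simp
  then have "\<forall>\<^sub>F h in at_right 0. small_step C e h \<and> exp ((A_f C + e) * h) * (1 + e) * B_y C * h * ?a < 1"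
    by (rule eventually_conj[OF eventually_small_step[OF nonneg(7,8) e(6)]])
  then obtain h1 where h1: "0 < h1" "\<And>h. 0 < h \<Longrightarrow> h < h1 \<Longrightarrow> small_step C e h"
    "\<And>h. 0 < h \<Longrightarrow> h < h1 \<Longrightarrow> exp ((A_f C + e) * h) * (1 + e) * B_y C * h * ?a < 1"
    unfolding eventually_at_right_field by auto
  \<comment> \<open>The eventual statements hold for \<open>h < h1\<close>; the half turns the
    required \<open>\<le>\<close> into this strict bound.\<close>
  have "contractive_scheme M W T C b \<sigma> f g n e ?a H c2 lam" if n: "1 \<le> n" "T / real n \<le> h1 / 2" for n
  proof -
    have "0 < T / real n" using n T by simp
    then have mesh: "0 < T / real n" "T / real n < h1" using n(2) h1(1) by linarith+
    interpret euler_scheme M W T C b \<sigma> f g n e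
      by (rule euler_scheme.intro[OF T bm coeff _ h1(2)[OF mesh]]) (use n in simp)
    have D: "D ?a = D1 e" "D ((1 + lam) * ?a) = D2 e" by (simp_all add: D_def D1_def D2_def)
    have conv1: "h * conv R_f (P ?a) j \<le> q1 e" if "j \<le> n" for j
      using conv_P_le[OF order_refl that, of ?a "D1 0"] unfolding D q1_def k1_def .
    have conv2: "h * conv R_f (P ((1 + lam) * ?a)) j \<le> q2 e" if "j \<le> n" for j
      using conv_P_le[OF order_refl that, of "(1 + lam) * ?a" "D2 0"] unfolding D q2_def k2_def .
    show ?thesis
    proof (rule contractive_scheme.intro[OF euler_scheme_axioms contractive_scheme_axioms.intro])
      show "P ?a j \<le> ?a" if "j \<le> n" for j
      proof -
        have "P ?a j \<le> (g_x C + (1 + e) * f_x C * T) * m"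
          unfolding m_def using P_le_of_exponent[of ?a Z j] e(1) that by (simp add: D)
        also have "\<dots> = L + f_x C * T * m * e" by (simp add: L_eq algebra_simps)
        also have "\<dots> \<le> ?a" using e(6) by (simp add: \<alpha>_def r_def distrib_right)
        finally show ?thesis .
      qed
      show "growth_profile ?a H j \<le> H" if "j \<le> n" for j
      proof -
        have "growth_profile ?a H j \<le> exp (max (A_f C + e) 0 * T) * g_0 C
            + (1 + e) * f_0 C * (T * (exp (e * T) * \<Gamma>0 (A_f C * T)) * exp (\<bar>A_f C + e\<bar> * e))
            + (1 + e) * (B_y C * H + B_0 C) * q1 e"
          by (rule growth_profile_le_of_conv[OF that H_nonneg conv1[OF that]])
        also have "(1 + e) * (B_y C * H + B_0 C) * q1 e = (1 + e) * B_0 C * q1 e + (1 + e) * B_y C * q1 e * H"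
          by (simp add: algebra_simps)
        also have "exp (max (A_f C + e) 0 * T) * g_0 C
            + (1 + e) * f_0 C * (T * (exp (e * T) * \<Gamma>0 (A_f C * T)) * exp (\<bar>A_f C + e\<bar> * e))
            + ((1 + e) * B_0 C * q1 e + (1 + e) * B_y C * q1 e * H) \<le> L2 + c1 * H"
          using e(2) mult_right_mono[OF less_imp_le[OF e(3)] H_nonneg] by linarith
        \<comment> \<open>\<open>L2 / (1 - c1)\<close> is the fixed point of
          \<open>H \<mapsto> L2 + c1 * H\<close>.\<close>
        also have "\<dots> = H"
        proof -
          have "H * (1 - c1) = L2" using c1(2) by (simp add: H)
          then show ?thesis by (simp add: algebra_simps)
        qed
        finally show ?thesis .
      qed
      show "max (exp (D ?a * T)) 1 * (1 + inverse lam) * (1 + e) * B_y C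
          * (h * conv R_f (P ((1 + lam) * ?a)) j) \<le> c2" if "j \<le> n" for j
      proof -
        have "max (exp (D ?a * T)) 1 * (1 + inverse lam) * (1 + e) * B_y C
            * (h * conv R_f (P ((1 + lam) * ?a)) j)
          \<le> max (exp (D ?a * T)) 1 * (1 + inverse lam) * (1 + e) * B_y C * q2 e"
          using nonneg lam e(6) by (intro mult_left_mono conv2 that) (simp add: le_max_iff_disj)
        then show ?thesis using e(4) unfolding D by linarith
      qed
      show "R_f * (1 + e) * B_y C * h * ?a < 1"
        using h1(3)[OF mesh] by (simp add: h_def)
    qed (use a H_nonneg c2_pos c2(2) lam in auto)
  qed
  then show ?thesis
    using e(5,7) h1(1) by (intro exI[of _ e] exI[of _ ?a] exI[of _ "h1 / 2"]) auto
qed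

section \<open>Choice of the Young parameter and proof of the three assertions\<close>

lemma obtain_c2_at_less:
  assumes "c2_fun T C L G < c"
  obtains lam where "0 < lam" "c2_at T C lam L G < c"
proof -
  have "(\<lambda>lam. c2_at T C lam L G) ` {0<..} \<noteq> {}" by simp
  then show ?thesis
    using cInf_lessD[of "(\<lambda>lam. c2_at T C lam L G) ` {0<..}" c] assms that
    by (auto simp: c2_fun_def)
qed

theorem theorem5p1:
  fixes M :: "'a measure" and W :: "real \<Rightarrow> 'a \<Rightarrow> real" and T :: real and C :: bounds
    and b \<sigma> :: "real \<Rightarrow> real \<Rightarrow> real \<Rightarrow> real"
    and f :: "real \<Rightarrow> real \<Rightarrow> real \<Rightarrow> real \<Rightarrow> real"
    and g :: "real \<Rightarrow> real"
    and Lbar Gbar Hbar L2 c1 :: real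
  assumes "T > 0"
    and "brownian_motion M W T"
    and "standing_assumption T C b \<sigma> f g"
    and "L0 T C < exp (- 1)"
    and "c2_fun T C (L1 T C) (L1 T C) < 1"
    and "Lbar > L1 T C"
    and "Gbar > L1 T C"
    and "L2 > L2_fun T C (L1 T C)"
    and "c1_fun T C (L1 T C) < c1" and "c1 < 1"
    and "Hbar = L2 / (1 - c1)"
  shows "\<exists>u :: nat \<Rightarrow> nat \<Rightarrow> real \<Rightarrow> real.
    (\<exists>h0>0. \<forall>n\<ge>1. T / real n \<le> h0 \<longrightarrow>
        solves_R M W T b \<sigma> f g n (u n) \<and> L_le n (u n) Lbar \<and> GH_le n (u n) Gbar Hbar) \<and>
    (\<forall>c2. c2_fun T C (L1 T C) (L1 T C) < c2 \<and> c2 < 1 \<longrightarrow>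
      (\<exists>h0>0. \<forall>n\<ge>1. T / real n \<le> h0 \<longrightarrow>
        (\<forall>m\<ge>1. \<forall>x.
          (MAX i\<in>{0..n}. \<bar>markov_iter M W T b \<sigma> f g n m i x - u n i x\<bar>\<^sup>2)
          \<le> 3 * Gbar / (1 - sqrt c2)^2 * \<bar>x\<bar>\<^sup>2 * c2 ^ m
            + 3 / (1 - sqrt c2)^4
              * (Hbar / real m + (b_0 C + \<sigma>_0 C + (b_y C + \<sigma>_y C) * Hbar) * T * Gbar)
              * real m * c2 ^ m))) \<and>
    (\<forall>G>0. \<exists>h0>0. \<forall>n\<ge>1. T / real n \<le> h0 \<longrightarrow>
      (\<forall>v. solves_R M W T b \<sigma> f g n v \<and> G_le n v G \<longrightarrow> (\<forall>i\<le>n. v i = u n i)))"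
proof -
  note T = assms(1) and bm = assms(2) and coeff = assms(3)
  \<comment> \<open>One witness has to serve every \<open>c2\<close> and \<open>G\<close>; the
    pointwise limit of the iteration depends on neither.\<close>
  let ?u = "\<lambda>n i x. lim (\<lambda>m. markov_iter M W T b \<sigma> f g n m i x)"
  let ?c = "c2_fun T C (L1 T C) (L1 T C)"
  \<comment> \<open>The same \<open>a\<close> bounds the Lipschitz and the growth constant, so it
    has to stay below both targets.\<close>
  define B where "B = min Lbar Gbar"
  have B: "L1 T C < B" "B \<le> Lbar" "B \<le> Gbar" using assms by (auto simp: B_def)
  have small: "\<exists>lam e a h0. e \<le> 1 \<and> a \<le> B \<and> 0 < h0 \<and>
      (\<forall>n\<ge>1. T / real n \<le> h0 \<longrightarrow> contractive_scheme M W T C b \<sigma> f g n e a Hbar c2 lam)"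
    if c2: "?c < c2" "c2 < 1" for c2
  proof -
    obtain lam where lam: "0 < lam" "c2_at T C lam (L1 T C) (L1 T C) < c2"
      using obtain_c2_at_less[OF c2(1)] .
    show ?thesis
      using contractive_scheme_for_small_mesh[OF T bm coeff assms(4) lam c2(2) B(1) assms(8-11)] by blast
  qed
  \<comment> \<open>For (i) and (iii) any contraction factor below 1 will do; (ii) builds a scheme
    for each given \<open>c2\<close>, with its own mesh bound.\<close>
  obtain c where c: "?c < c" "c < 1" using dense[OF assms(5)] by blast
  obtain lam e a h0 where base: "a \<le> B" "0 < h0"
    "\<And>n. 1 \<le> n \<Longrightarrow> T / real n \<le> h0 \<Longrightarrow> contractive_scheme M W T C b \<sigma> f g n e a Hbar c lam"
    using small[OF c] by blast
  have i: "solves_R M W T b \<sigma> f g n (?u n) \<and> L_le n (?u n) Lbar \<and> GH_le n (?u n) Gbar Hbar"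
    if n: "1 \<le> n" "T / real n \<le> h0" for n
  proof -
    interpret contractive_scheme M W T C b \<sigma> f g n e a Hbar c lam
      by (rule base(3)[OF n])
    have u: "?u n = u" by (intro ext) (simp add: u_def)
    have le: "a * z\<^sup>2 \<le> Lbar * z\<^sup>2" "a * z\<^sup>2 \<le> Gbar * z\<^sup>2" for z
      using base(1) B(2,3) by (auto intro!: mult_right_mono)
    have "L_le n u Lbar"
      unfolding L_le_def power2_abs
      using order_trans[OF invariantD(1)[OF invariant_u] le(1)] by blast
    moreover have "GH_le n u Gbar Hbar"
      unfolding GH_le_def power2_abs
      using order_trans[OF invariantD(2)[OF invariant_u] add_right_mono[OF le(2)]] by blast
    ultimately show ?thesis
      unfolding u using solves_u by blast
  qed
  have iii: "v i = ?u n i"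
    if "1 \<le> n" "T / real n \<le> h0" "solves_R M W T b \<sigma> f g n v" "i \<le> n" for n v i
  proof -
    interpret contractive_scheme M W T C b \<sigma> f g n e a Hbar c lam
      by (rule base(3)[OF that(1,2)])
    show ?thesis using solution_unique[OF that(3,4)] by (simp add: u_def fun_eq_iff)
  qed
  have ii: "\<exists>h0>0. \<forall>n\<ge>1. T / real n \<le> h0 \<longrightarrow> (\<forall>m\<ge>1. \<forall>x.
      (MAX i\<in>{0..n}. \<bar>markov_iter M W T b \<sigma> f g n m i x - ?u n i x\<bar>\<^sup>2)
        \<le> 3 * Gbar / (1 - sqrt c2)^2 * \<bar>x\<bar>\<^sup>2 * c2 ^ m
          + 3 / (1 - sqrt c2)^4
            * (Hbar / real m + (b_0 C + \<sigma>_0 C + (b_y C + \<sigma>_y C) * Hbar) * T * Gbar)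
            * real m * c2 ^ m)"
    if c2: "?c < c2" "c2 < 1" for c2
  proof -
    obtain lam e a h0 where sch: "e \<le> 1" "a \<le> B" "0 < h0"
      "\<And>n. 1 \<le> n \<Longrightarrow> T / real n \<le> h0 \<Longrightarrow> contractive_scheme M W T C b \<sigma> f g n e a Hbar c2 lam"
      using small[OF c2] by blast
    have "(MAX i\<in>{0..n}. \<bar>markov_iter M W T b \<sigma> f g n m i x - ?u n i x\<bar>\<^sup>2)
        \<le> 3 * Gbar / (1 - sqrt c2)^2 * \<bar>x\<bar>\<^sup>2 * c2 ^ m
          + 3 / (1 - sqrt c2)^4
            * (Hbar / real m + (b_0 C + \<sigma>_0 C + (b_y C + \<sigma>_y C) * Hbar) * T * Gbar)
            * real m * c2 ^ m"
      if n: "1 \<le> n" "T / real n \<le> h0" and m: "1 \<le> m" for n m x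
    proof -
      interpret contractive_scheme M W T C b \<sigma> f g n e a Hbar c2 lam
        by (rule sch(4)[OF n])
      define s where "s = 1 - sqrt c2"
      have s: "0 < s" "s \<le> 1" using c_bounds by (auto simp: s_def real_sqrt_less_iff)
      \<comment> \<open>\<open>rate\<close> contains no power of \<open>1 / s\<close>, so lower
        bounds for the two prefactors suffice; the 3 covers the factor \<open>1 + e \<le> 2\<close>
        in \<open>\<kappa>\<close>.\<close>
      have s2: "3 \<le> 3 / s ^ 2" "3 \<le> 3 / s ^ 4"
        using s power_le_one[of s 2] power_le_one[of s 4] by (auto simp: le_divide_eq)
      define K where "K = B_y C * Hbar + B_0 C"
      have K: "0 \<le> K" using constants_nonneg H_nonneg by (simp add: K_def)
      then have \<kappa>: "\<kappa> \<le> 3 * K"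
        using sch(1) unfolding \<kappa>_def K_def by (intro mult_right_mono) auto
      have G: "a \<le> Gbar" "0 \<le> Gbar" using sch(2) B(3) a_nonneg by auto
      have "rate m x = (a * x\<^sup>2) * c2 ^ m + (Hbar + \<kappa> * (T * a * real m)) * c2 ^ m"
        by (simp add: rate_def mult_ac)
      also have "\<dots> \<le> (3 / s ^ 2 * (Gbar * x\<^sup>2)) * c2 ^ m + (3 / s ^ 4 * (Hbar + K * (T * Gbar * real m))) * c2 ^ m"
      proof (intro add_mono mult_right_mono)
        have "1 * (a * x\<^sup>2) \<le> 3 / s ^ 2 * (Gbar * x\<^sup>2)"
          using s2(1) G a_nonneg by (intro mult_mono mult_right_mono) auto
        then show "a * x\<^sup>2 \<le> 3 / s ^ 2 * (Gbar * x\<^sup>2)" by simp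
        have "\<kappa> * (T * a * real m) \<le> 3 * K * (T * Gbar * real m)"
          using K \<kappa> \<kappa>_nonneg T G a_nonneg by (intro mult_mono mult_nonneg_nonneg) auto
        then have "Hbar + \<kappa> * (T * a * real m) \<le> 3 * (Hbar + K * (T * Gbar * real m))"
          using H_nonneg by (simp add: algebra_simps)
        also have "\<dots> \<le> 3 / s ^ 4 * (Hbar + K * (T * Gbar * real m))"
          using s2(2) H_nonneg K T G by (intro mult_right_mono) auto
        finally show "Hbar + \<kappa> * (T * a * real m) \<le> 3 / s ^ 4 * (Hbar + K * (T * Gbar * real m))" .
      qed (use c_bounds in auto)
      also have "\<dots> = 3 * Gbar / s ^ 2 * \<bar>x\<bar>\<^sup>2 * c2 ^ m + 3 / s ^ 4 * (Hbar / real m + K * T * Gbar) * real m * c2 ^ m"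
      proof -
        have "(Hbar / real m + K * T * Gbar) * real m = Hbar + K * (T * Gbar * real m)"
          using m by (simp add: distrib_right)
        then have eq: "3 / s ^ 4 * (Hbar / real m + K * T * Gbar) * real m * c2 ^ m
            = 3 / s ^ 4 * (Hbar + K * (T * Gbar * real m)) * c2 ^ m"
          by (simp only: mult.assoc)
        show ?thesis unfolding eq by (simp add: mult_ac)
      qed
      also have "K = b_0 C + \<sigma>_0 C + (b_y C + \<sigma>_y C) * Hbar"
        by (simp add: K_def B_y_def B_0_def)
      finally have rate: "rate m x \<le> 3 * Gbar / (1 - sqrt c2)^2 * \<bar>x\<bar>\<^sup>2 * c2 ^ m
          + 3 / (1 - sqrt c2)^4
            * (Hbar / real m + (b_0 C + \<sigma>_0 C + (b_y C + \<sigma>_y C) * Hbar) * T * Gbar)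
            * real m * c2 ^ m"
        unfolding s_def .
      have "\<bar>markov_iter M W T b \<sigma> f g n m i x - ?u n i x\<bar>\<^sup>2 \<le> rate m x" if "i \<le> n" for i
        using u_diff_le[OF that, of x m] by (simp add: u_def power2_commute)
      then show ?thesis
        by (intro order_trans[OF _ rate] Max.boundedI) auto
    qed
    then show ?thesis using sch(3) by blast
  qed
  show ?thesis
    using i ii iii base(2) by (intro exI[of _ ?u] conjI allI impI) blast+
qed

end
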